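(* There exists an absolute real constant $g\in[0.551,0.552)$ (i.e. $g=0.551\ldots$) such that for every $f\in\mathcal{S}_b$, the third logarithmic coefficient $\gamma_3$ of $f$ satisfies $$|\gamma_3|\le g.$$
   Context: Let $\mathbb{D}=\{z\in\mathbb{C}:|z|<1\}$. $\mathcal{S}$ is the class of functions $f$ that are analytic and univalent (injective) in $\mathbb{D}$ with expansion $f(z)=z+a_2z^2+a_3z^3+\cdots$. $\mathcal{S}_b\subset\mathcal{S}$ is the class of (normalized) bi-univalent functions: those $f\in\mathcal{S}$ whose inverse function $f^{-1}$ is also univalent in $\mathbb{D}$, meaning that the inverse of $f$ near the origin (with $f^{-1}(0)=0$) extends to an analytic univalent function on $\mathbb{D}$. (For example $z$, $z/(1-z)$ and $\frac12\log\frac{1+z}{1-z}$ belong to $\mathcal{S}_b$.) The logarithmic coefficients $\gamma_n$ of $f\in\mathcal{S}$ are defined by $\log\frac{f(z)}{z}=2\sum_{n=1}^{\infty}\gamma_nz^n$ for $z\in\mathbb{D}$, where the branch of the logarithm vanishes at $z=0$; in particular $\gamma_3=\frac12\left(a_4-a_2a_3+\frac13a_2^3\right)$. *)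

theory Defs
  imports "HOL-Complex_Analysis.Complex_Analysis"
begin

(* Only the values on the open unit disc matter; functions in HOL are total, and nothing is
   required of f elsewhere. *)
definition class_S :: "(complex \<Rightarrow> complex) set" where
  "class_S = {f. f holomorphic_on ball 0 1 \<and> inj_on f (ball 0 1) \<and> f 0 = 0 \<and> deriv f 0 = 1}"

(* The disc need not be contained in the image of f (take f z = z / (1 - z)), so the inverse of f
   is compared with its univalent extension g only near the origin, where f is invertible. *)
definition class_S_b :: "(complex \<Rightarrow> complex) set" where
  "class_S_b = {f \<in> class_S. \<exists>g. g holomorphic_on ball 0 1 \<and> inj_on g (ball 0 1) \<and>
     (\<forall>\<^sub>F w in nhds 0. g w = inv_into (ball 0 1) f w)}"

definition is_log_branch :: "(complex \<Rightarrow> complex) \<Rightarrow> (complex \<Rightarrow> complex) \<Rightarrow> bool" where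
  "is_log_branch f L \<longleftrightarrow> L holomorphic_on ball 0 1 \<and> L 0 = 0 \<and>
     (\<forall>z \<in> ball 0 1 - {0}. exp (L z) = f z / z)"

(* On the disc the choice is determined, see is_log_branch_unique. *)
definition log_branch :: "(complex \<Rightarrow> complex) \<Rightarrow> complex \<Rightarrow> complex" where
  "log_branch f = (SOME L. is_log_branch f L)"

(* Half the n-th Taylor coefficient of log (f z / z); see log_coeff_sums. *)
definition log_coeff :: "(complex \<Rightarrow> complex) \<Rightarrow> nat \<Rightarrow> complex" where
  "log_coeff f n = fps_nth (fps_expansion (log_branch f) 0) n / 2"

lemma log_branch_exists:
  assumes "f \<in> class_S"
  shows "\<exists>L. is_log_branch f L"
proof -
  from assms have hol: "f holomorphic_on ball 0 1" and inj: "inj_on f (ball 0 1)"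
    and f0: "f 0 = 0" and d: "deriv f 0 = 1"
    by (auto simp: class_S_def)
  define h where "h = (\<lambda>z. if z = 0 then 1 else f z / z)"
  have hh: "h holomorphic_on ball 0 1"
    by (rule pole_theorem_0[OF hol, of 0]) (auto simp: h_def f0 d)
  have nz: "h z \<noteq> 0" if "z \<in> ball 0 1" for z
    using that inj f0 by (auto simp: h_def inj_on_def)
  obtain g where g: "g holomorphic_on ball 0 1" "\<And>z. z \<in> ball 0 1 \<Longrightarrow> h z = exp (g z)"
    using contractible_imp_holomorphic_log[OF hh convex_imp_contractible nz] by auto
  have "exp (g 0) = 1"
    using g(2)[of 0] by (simp add: h_def)
  moreover have "exp (g z) = f z / z" if "z \<noteq> 0" "norm z < 1" for z
    using that g(2)[of z] by (simp add: h_def)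
  ultimately have "is_log_branch f (\<lambda>z. g z - g 0)"
    using g(1) by (auto simp: is_log_branch_def exp_diff intro!: holomorphic_intros)
  then show ?thesis by blast
qed

lemma is_log_branch_log_branch:
  "f \<in> class_S \<Longrightarrow> is_log_branch f (log_branch f)"
  unfolding log_branch_def by (rule someI_ex[OF log_branch_exists])

lemma is_log_branch_unique:
  assumes L: "is_log_branch f L" and M: "is_log_branch f M" and z: "z \<in> ball 0 1"
  shows "L z = M z"
proof -
  define D where "D = (\<lambda>z. L z - M z)"
  have hD: "D holomorphic_on ball 0 1"
    using L M by (auto simp: D_def is_log_branch_def intro!: holomorphic_intros)
  have e: "exp (D w) = 1" if "w \<in> ball 0 1" for w
  proof (cases "w = 0")
    case False
    then have "exp (L w) = exp (M w)"
      using L M that by (auto simp: is_log_branch_def)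
    then show ?thesis by (simp add: D_def exp_diff)
  qed (use L M in \<open>auto simp: D_def is_log_branch_def\<close>)
  have "(D has_field_derivative 0) (at w)" if w: "w \<in> ball 0 1" for w
  proof -
    have dD: "(D has_field_derivative deriv D w) (at w)"
      using hD w holomorphic_derivI open_ball by blast
    then have "((\<lambda>x. exp (D x)) has_field_derivative exp (D w) * deriv D w) (at w)"
      by (rule DERIV_fun_exp)
    moreover have "((\<lambda>x. exp (D x)) has_field_derivative 0) (at w)"
      by (rule has_field_derivative_transform_within_open[OF DERIV_const open_ball w])
        (use e in auto)
    ultimately have "exp (D w) * deriv D w = 0"
      by (rule DERIV_unique)
    then show ?thesis using dD by simp
  qed
  then have "\<exists>c. \<forall>x\<in>ball 0 1. D x = c"
    by (intro has_field_derivative_zero_constant) (auto intro: has_field_derivative_at_within)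
  then have "D z = D 0"
    using z by (metis centre_in_ball zero_less_one)
  then show ?thesis
    using L M by (simp add: D_def is_log_branch_def)
qed

lemma log_coeff_sums:
  assumes "f \<in> class_S" "z \<in> ball 0 1"
  shows "(\<lambda>n. 2 * log_coeff f (Suc n) * z ^ Suc n) sums log_branch f z"
proof -
  have L: "is_log_branch f (log_branch f)"
    using assms(1) by (rule is_log_branch_log_branch)
  then have "(\<lambda>n. (deriv ^^ n) (log_branch f) 0 / fact n * (z - 0) ^ n) sums log_branch f z"
    using assms(2) by (intro holomorphic_power_series) (auto simp: is_log_branch_def)
  then have "(\<lambda>n. 2 * log_coeff f n * z ^ n) sums log_branch f z"
    by (simp add: log_coeff_def fps_expansion_def)
  moreover have "log_coeff f 0 = 0"
    using L by (simp add: log_coeff_def fps_expansion_def is_log_branch_def)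
  ultimately show ?thesis
    by (subst sums_Suc_iff) simp
qed

lemma log_coeff_3:
  assumes "f \<in> class_S" and "\<And>n. a n = fps_nth (fps_expansion f 0) n"
  shows "log_coeff f 3 = (a 4 - a 2 * a 3 + a 2 ^ 3 / 3) / 2"
proof -
  define L where "L = log_branch f"
  have L: "L holomorphic_on ball 0 1" "L 0 = 0" "\<And>z. z \<in> ball 0 1 - {0} \<Longrightarrow> exp (L z) = f z / z"
    using is_log_branch_log_branch[OF assms(1)] by (auto simp: L_def is_log_branch_def)
  have f: "f holomorphic_on ball 0 1" "f 0 = 0"
    using assms(1) by (auto simp: class_S_def)
  define h where "h = (\<lambda>z. exp (L z))"
  have hol: "h holomorphic_on ball 0 1"
    unfolding h_def by (intro holomorphic_intros L)
  define H K F where "H = fps_expansion h 0" "K = fps_expansion L 0" "F = fps_expansion f 0"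
  have exph: "h has_fps_expansion H" and expL: "L has_fps_expansion K" and expf: "f has_fps_expansion F"
    unfolding H_K_F_def using hol L f
    by (auto intro!: has_fps_expansion_fps_expansion[of "ball 0 1"])
  have ev: "\<forall>\<^sub>F z in nhds 0. z \<in> ball (0::complex) 1"
    by (intro eventually_nhds_in_open) auto
  have "deriv h z = h z * deriv L z" if "z \<in> ball 0 1" for z
  proof -
    have "(L has_field_derivative deriv L z) (at z)"
      using L(1) that holomorphic_derivI open_ball by blast
    then show ?thesis
      unfolding h_def by (intro DERIV_imp_deriv DERIV_fun_exp)
  qed
  then have "\<forall>\<^sub>F z in nhds 0. deriv h z = h z * deriv L z"
    using ev by (auto elim: eventually_mono)
  moreover have "deriv h has_fps_expansion fps_deriv H"
    "(\<lambda>z. h z * deriv L z) has_fps_expansion H * fps_deriv K"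
    by (intro fps_expansion_intros exph expL)+
  ultimately have dH: "fps_deriv H = H * fps_deriv K"
    using fps_expansion_unique_complex has_fps_expansion_cong by metis
  have "f z = z * h z" if "z \<in> ball 0 1" for z
    using L(3)[of z] f(2) that by (cases "z = 0") (auto simp: h_def)
  then have "\<forall>\<^sub>F z in nhds 0. f z = z * h z"
    using ev by (auto elim: eventually_mono)
  moreover have "(\<lambda>z. z * h z) has_fps_expansion fps_X * H"
    by (intro fps_expansion_intros exph)
  ultimately have F: "F = fps_X * H"
    using expf fps_expansion_unique_complex has_fps_expansion_cong by metis
  have a: "a (Suc n) = fps_nth H n" for n
    unfolding assms(2) H_K_F_def(3)[symmetric] F by simp
  have l: "fps_nth K n = 2 * log_coeff f n" for n
    by (simp add: log_coeff_def H_K_F_def L_def)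
  have H0: "fps_nth H 0 = 1"
    by (simp add: H_K_F_def fps_expansion_def h_def L)
  have "fps_nth (fps_deriv H) n = fps_nth (H * fps_deriv K) n" for n
    by (simp only: dH)
  from this[of 0] this[of 1] this[of 2]
  have "fps_nth H 1 = fps_nth K 1"
    "2 * fps_nth H 2 = 2 * fps_nth K 2 + fps_nth H 1 * fps_nth K 1"
    "3 * fps_nth H 3 = 3 * fps_nth K 3 + 2 * fps_nth H 1 * fps_nth K 2 + fps_nth H 2 * fps_nth K 1"
    by (auto simp: fps_mult_nth H0 numeral_2_eq_2 numeral_3_eq_3 algebra_simps)
  moreover have "a 2 = fps_nth H 1" "a 3 = fps_nth H 2" "a 4 = fps_nth H 3"
    using a[of 1] a[of 2] a[of 3] by (simp_all add: eval_nat_numeral)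
  ultimately have k2: "fps_nth K 2 = a 3 - a 2 ^ 2 / 2"
    and k3: "3 * fps_nth K 3 = 3 * a 4 - 2 * a 2 * fps_nth K 2 - a 3 * a 2"
    by (auto simp: power2_eq_square field_simps)
  have "3 * fps_nth K 3 = 3 * (a 4 - a 2 * a 3 + a 2 ^ 3 / 3)"
    unfolding k3 k2 by (simp add: algebra_simps power2_eq_square power3_eq_cube)
  then have "fps_nth K 3 = a 4 - a 2 * a 3 + a 2 ^ 3 / 3"
    by (subst (asm) mult_left_cancel) simp_all
  then show ?thesis
    using l[of 3] by (metis nonzero_mult_div_cancel_left zero_neq_numeral)
qed

end

theory Submission
  imports Defs
begin

text \<open>
  Let e be the branch of (f(z)/z) to the power -1/2, with coefficients 1, c1, c2, c3. The odd
  transform 1/sqrt(f(z^2)) = e(z^2)/z is univalent with a simple pole at 0, so the area theorem gives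
  |c1|^2 + 3|c2|^2 + 5|c3|^2 \<le> 1. With x = -c1, y = -c2, w = -c3 the third logarithmic coefficient is
  w + xy + x^3/3. This inequality alone gives only the bound 0.5566, valid on the whole class S.
  The univalent extension of the inverse also belongs to S, and its parameters are -x, x^2 - y and,
  up to sign, 2x^3 - 4xy + w; they satisfy the same inequality, and the two constraints
  together bring the bound below 0.552 (numerically to 0.5517, near |x| = 0.752).
\<close>

section \<open>Optimisation of the coefficient functional\<close>

text \<open>The inverse becomes transparent after centring: for real \<open>x\<close> and
  \<open>v = y - x^2/2\<close>, the second inequality is the first with \<open>v\<close> replaced by
  \<open>-v\<close> and \<open>w\<close> by \<open>w - 4*x*v\<close>, while the functional is
  \<open>w + x*v + 5/6*x^3\<close>. The maximiser for the first inequality alone has negative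
  \<open>v\<close>, which is what the second one penalises. A suitable convex combination moves the
  extremal point to \<open>v = 0\<close>, where the two inequalities coincide and say
  \<open>5*|w|^2 <= 1 - x^2 - 3/4*x^4\<close>. The constant 0.55195 lies between the resulting
  maximum and 0.552, with room to replace the square root in \<open>x\<close> by two tangent lines.

  The classical area theorem identifies an enclosed area with a boundary integral. Here inequalities
  suffice: the image of an annulus lies inside a nearly elliptic region, and its area is at least a
  finite Bessel sum. So no Jordan curve or Green formula enters, but the comparison region must be
  accurate enough for the error to vanish with the inner radius.\<close>

text \<open>For \<open>x\<close> up to 2/3 the first inequality is enough: Cauchy-Schwarz with
  weights adapted to the factors 5 and 3, then a tangent line instead of the square root.\<close>

lemma functional_bound_small:
  fixes x :: real and y w :: complex
  assumes x: "0 \<le> x" "x \<le> 2/3" and C1: "x^2 + 3 * (norm y)^2 + 5 * (norm w)^2 \<le> 1"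
  shows "norm (w + x * y + x^3/3) \<le> 0.55"
proof -
  have "norm (w + x * y + x^3/3) \<le> norm w + x * norm y + x^3/3"
    using x by (intro order_trans[OF norm_triangle_ineq] add_mono order_trans[OF norm_triangle_ineq])
      (auto simp: norm_mult norm_power norm_divide)
  moreover have "norm w + x * norm y \<le> (1/5 + x^2/3) * (1-x^2) / (9/10) + 9/40"
  proof -
    have "(norm w + x * norm y)^2 \<le> (1/5 + x^2/3) * (5 * (norm w)^2 + 3 * (norm y)^2)"
    proof -
      have "(1/5 + x^2/3) * (5 * (norm w)^2 + 3 * (norm y)^2) - (norm w + x * norm y)^2
        = (5 * x * norm w - 3 * norm y)^2 / 15"
        by (simp add: field_simps power2_eq_square)
      then show ?thesis by (smt (verit) zero_le_power2 zero_le_divide_iff)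
    qed
    also have "\<dots> \<le> (1/5 + x^2/3) * (1-x^2)"
      using C1 by (intro mult_left_mono) auto
    finally have "(norm w + x * norm y)^2 \<le> (1/5 + x^2/3) * (1-x^2)" .
    \<comment> \<open>Tangent at 0.45: on this range of \<open>x\<close> the root of
      \<open>(1/5 + x^2/3) * (1-x^2)\<close> stays between about 0.44 and 0.462.\<close>
    moreover have "norm w + x * norm y \<le> (norm w + x * norm y)^2 / (9/10) + 9/40"
    proof -
      have "0 \<le> (norm w + x * norm y - 0.45)^2" by simp
      then show ?thesis by (simp add: power2_eq_square field_simps)
    qed
    moreover have "(norm w + x * norm y)^2 / (9/10) \<le> (1/5 + x^2/3) * (1-x^2) / (9/10)"
      using calculation(1) by (rule divide_right_mono) simp
    ultimately show ?thesis by linarith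
  qed
  moreover have "(1/5 + x^2/3) * (1-x^2) / (9/10) + 9/40 + x^3/3 \<le> 0.55"
  proof -
    have e: "(1/5 + x^2/3) * (1-x^2) / (9/10) + 9/40 + x^3/3
       = 2/9 + 9/40 + x^2 * (4/27 + x/3 - 10/27*x^2)"
      by (simp add: field_simps power2_eq_square power3_eq_cube)
    \<comment> \<open>9/20 is the vertex of the quadratic factor, whose maximum is just below
      0.2235.\<close>
    have "0 \<le> (x - 9/20)^2" by simp
    then have "4/27 + x/3 - 10/27*x^2 \<le> 0.2235" by (simp add: power2_eq_square field_simps)
    moreover have "x^2 \<le> 4/9" using power_mono[OF x(2) x(1), of 2] by (simp add: power2_eq_square)
    ultimately have "x^2 * (4/27 + x/3 - 10/27*x^2) \<le> 4/9 * 0.2235"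
      using x by (intro order_trans[OF mult_left_mono[where b = "0.2235"] mult_right_mono]) auto
    then show ?thesis unfolding e by simp
  qed
  ultimately show ?thesis by linarith
qed

lemma norm_add_of_real_mult_squared: 
  fixes z v :: complex and r :: real
  shows "(norm (z + r * v))^2 = (norm z)^2 + 2 * r * (Re z * Re v + Im z * Im v) + r^2 * (norm v)^2"
  by (simp only: cmod_power2) (simp add: power2_eq_square algebra_simps)

text \<open>\<open>W\<close> is a guess for the size of \<open>w\<close> at the extremal point: the
  best choice \<open>sqrt (A/5)\<close> would turn the bound into
  \<open>sqrt (A/5) + 5/6 * x^3\<close>, attained at \<open>v = 0\<close>, \<open>w = W\<close>. A
  fixed \<open>W\<close> leaves a polynomial in \<open>x\<close>.\<close>

lemma functional_bound_large:
  fixes x W :: real and y w :: complex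
  defines "A \<equiv> 1 - x^2 - 3/4 * x^4"
  assumes x: "2/3 \<le> x" "x \<le> 1" and W: "0.18 \<le> W" "W \<le> 0.2"
    and C1: "x^2 + 3 * (norm y)^2 + 5 * (norm w)^2 \<le> 1"
    and C2: "x^2 + 3 * (norm (x^2 - y))^2 + 5 * (norm (2 * x^3 - 4 * x * y + w))^2 \<le> 1"
  shows "norm (w + x * y + x^3/3) \<le> W/2 + A / (10 * W) + 5/6 * x^3"
proof -
  \<comment> \<open>\<open>\<theta>\<close> makes the terms linear in \<open>v\<close> cancel in \<open>(1 - \<theta>) C1 + \<theta> C2\<close>.\<close>
  define \<theta> where "\<theta> = (3*x - 10*W) / (40*W + 6*x)"
  have den: "40*W + 6*x > 0" and Wp: "W > 0" and xp: "x > 0" using x W by auto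
  \<comment> \<open>A nonnegative weight means \<open>10*W <= 3*x\<close>, which
    \<open>W <= 0.2\<close> and \<open>2/3 <= x\<close> just guarantee. The upper bound uses
    \<open>0.18 <= W\<close> and \<open>x <= 1\<close>.\<close>
  have \<theta>: "0 \<le> \<theta>" "\<theta> \<le> 0.1" unfolding \<theta>_def using x W den by (auto simp: field_simps)
  have eq: "10 * W * (1 + 4 * \<theta>) = 3 * x * (1 - 2 * \<theta>)"
    unfolding \<theta>_def using den by (simp add: field_simps)
  define v where "v = y - x^2/2"
  \<comment> \<open>The same mixture \<open>(1-\<theta>)*w + \<theta>*(w - 4*x*v)\<close> of the two
    third parameters. Mixing the squared norms then gives \<open>|u|^2\<close> plus a multiple of
    \<open>|v|^2\<close>, which is the extra term in \<open>K\<close>.\<close>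
  define u where "u = w + of_real (- 4 * \<theta> * x) * v"
  define m c where "m = (1 + 4 * \<theta>) * x" and "c = 5/6 * x^3"
  have cp: "c > 0" using xp by (simp add: c_def)
  have y: "y = of_real (x^2/2) + of_real 1 * v" and y': "x^2 - y = of_real (x^2/2) + of_real (-1) * v"
    by (auto simp: v_def)
  have w4: "2 * x^3 - 4 * x * y + w = w + of_real (-4*x) * v"
    by (simp add: v_def algebra_simps power2_eq_square power3_eq_cube)
  have N1: "(norm y)^2 = x^4/4 + x^2 * Re v + (norm v)^2"
    unfolding y norm_add_of_real_mult_squared by (simp add: norm_mult norm_divide norm_power power_divide)
  have N2: "(norm (x^2 - y))^2 = x^4/4 - x^2 * Re v + (norm v)^2"
    unfolding y' norm_add_of_real_mult_squared by (simp add: norm_mult norm_divide norm_power power_divide)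
  define q where "q = Re w * Re v + Im w * Im v"
  have N3: "(norm (2 * x^3 - 4 * x * y + w))^2 = (norm w)^2 - 8 * x * q + 16 * x^2 * (norm v)^2"
    unfolding w4 norm_add_of_real_mult_squared q_def by (simp add: power_mult_distrib)
  have N4: "(norm u)^2 = (norm w)^2 - 8 * \<theta> * x * q + 16 * \<theta>^2 * x^2 * (norm v)^2"
    unfolding u_def norm_add_of_real_mult_squared q_def by (simp add: power_mult_distrib)
  define K where "K = 3 + 80 * \<theta> * (1 - \<theta>) * x^2"
  have K3: "K \<ge> 3" unfolding K_def using \<theta> by simp
  have "(1-\<theta>) * (x^2 + 3 * (norm y)^2 + 5 * (norm w)^2) +
    \<theta> * (x^2 + 3 * (norm (x^2 - y))^2 + 5 * (norm (2 * x^3 - 4 * x * y + w))^2) \<le> (1-\<theta>) * 1 + \<theta> * 1"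
    using C1 C2 \<theta> by (intro add_mono mult_left_mono) auto
  then have main: "5 * (norm u)^2 \<le> A - 3 * x^2 * (1 - 2*\<theta>) * Re v - K * (norm v)^2"
    unfolding N1 N2 N3 N4 A_def K_def by (simp add: field_simps power2_eq_square)
  have "norm (w + x * y + x^3/3) = norm (u + (of_real c + of_real m * v))"
    by (rule arg_cong[of _ _ norm])
       (simp add: u_def v_def m_def c_def algebra_simps power2_eq_square power3_eq_cube)
  also have "\<dots> \<le> norm u + norm (of_real c + of_real m * v)" by (rule norm_triangle_ineq)
  also have "norm u \<le> (norm u)^2 / (2*W) + W/2"
  proof -
    have "0 \<le> (norm u - W)^2" by simp
    then show ?thesis using Wp by (simp add: power2_eq_square field_simps)
  qed
  also have "(norm u)^2 / (2*W) \<le> (A - 3 * x^2 * (1 - 2*\<theta>) * Re v - K * (norm v)^2) / (10 * W)"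
    using main Wp by (simp add: field_simps)
  also have "\<dots> = A / (10*W) - m * Re v - K / (10*W) * (norm v)^2"
  proof -
    have "3 * x^2 * (1 - 2*\<theta>) = 10 * W * m" unfolding m_def using eq by (simp add: power2_eq_square)
    then show ?thesis using Wp by (simp add: diff_divide_distrib)
  qed
  also have "norm (of_real c + of_real m * v) \<le> c + m * Re v + m^2 * (norm v)^2 / (2*c)"
  proof -
    have "(norm (of_real c + of_real m * v))^2 = c^2 + 2 * m * c * Re v + m^2 * (norm v)^2"
      unfolding norm_add_of_real_mult_squared by simp
    moreover have "norm (of_real c + of_real m * v) \<le> (norm (of_real c + of_real m * v))^2 / (2*c) + c/2"
    proof -
      have "0 \<le> (norm (of_real c + of_real m * v) - c)^2" by simp
      then show ?thesis using cp by (simp add: power2_eq_square field_simps)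
    qed
    ultimately show ?thesis using cp by (simp add: field_simps power2_eq_square)
  qed
  \<comment> \<open>By \<open>4*a*b <= (a+b)^2\<close> with \<open>a = 40*W\<close> and
    \<open>b = 6*x\<close>, the coefficient on the left is at most \<open>0.2025/W\<close>, hence
    below \<open>3/(10*W)\<close>.\<close>
  also have "m^2 * (norm v)^2 / (2*c) \<le> K / (10*W) * (norm v)^2"
  proof -
    have "m^2 / (2*c) = 3/5 * (1+4*\<theta>)^2 / x" 
      using xp by (simp add: m_def c_def power2_eq_square power3_eq_cube)
    also have "1 + 4 * \<theta> = 18 * x / (40*W + 6*x)"
      unfolding \<theta>_def using den by (simp add: field_simps)
    also have "3/5 * (18 * x / (40*W + 6*x))^2 / x = 3/5 * 324 * x / (40*W + 6*x)^2"
      using xp by (simp add: power_divide power2_eq_square)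
    also have "\<dots> \<le> 3/5 * 324 * x / (960 * W * x)"
    proof (rule divide_left_mono)
      have "0 \<le> (40*W - 6*x)^2" by simp
      then show "960 * W * x \<le> (40*W + 6*x)^2" by (simp add: power2_eq_square algebra_simps)
    qed (use den xp Wp in auto)
    also have "\<dots> \<le> 3 / (10*W)"
      using xp Wp by (simp add: field_simps)
    also have "\<dots> \<le> K / (10*W)"
      using K3 Wp by (intro divide_right_mono) auto
    finally have "m^2 / (2*c) \<le> K / (10*W)" .
    then show ?thesis by (metis mult_right_mono times_divide_eq_left zero_le_power2)
  qed
  finally show ?thesis unfolding c_def by simp
qed

lemma functional_bound_real:
  fixes x :: real and y w :: complex
  assumes x0: "0 \<le> x"
    and C1: "x^2 + 3 * (norm y)^2 + 5 * (norm w)^2 \<le> 1"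
    and C2: "x^2 + 3 * (norm (x^2 - y))^2 + 5 * (norm (2 * x^3 - 4 * x * y + w))^2 \<le> 1"
  shows "norm (w + x * y + x^3/3) \<le> 0.55195"
proof -
  have "x^2 \<le> 1" using C1 by (smt (verit) zero_le_power2)
  then have x1: "x \<le> 1" using x0 by (simp add: abs_square_le_1)
  \<comment> \<open>At 2/3 the weight \<open>\<theta>\<close> for \<open>W = 1/5\<close> vanishes.
    The bound for \<open>W = 1/5\<close> increases up to 19/25 and the one for
    \<open>W = 9/50\<close> decreases from there; at 19/25, slightly beyond the critical
    \<open>x\<close>, both are below 0.55195.\<close>
  consider "x \<le> 2/3" | "2/3 \<le> x" "x \<le> 19/25" | "19/25 \<le> x" by linarith
  then show ?thesis
  proof cases
    case 1
    then show ?thesis using functional_bound_small[OF x0 _ C1] by simp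
  next
    case 2
    let ?g = "\<lambda>x::real. 3/5 - x^2/2 - 3/8 * x^4 + 5/6 * x^3"
    have "?g x \<le> ?g (19/25)"
    proof (rule DERIV_nonneg_imp_nondecreasing[OF 2(2)])
      fix t :: real assume t: "x \<le> t" "t \<le> 19/25"
      have "(?g has_real_derivative 3/2 * t * (t - 2/3) * (1 - t)) (at t)"
        by (auto intro!: derivative_eq_intros simp: field_simps power2_eq_square power3_eq_cube)
      moreover have "0 \<le> 3/2 * t * (t - 2/3) * (1 - t)" using t 2 by simp
      ultimately show "\<exists>y. (?g has_real_derivative y) (at t) \<and> 0 \<le> y" by blast
    qed
    also have "\<dots> \<le> 0.55195" by (simp add: power2_eq_square power3_eq_cube power4_eq_xxxx)
    finally have "?g x \<le> 0.55195" .
    moreover have "norm (w + x * y + x^3/3) \<le> ?g x"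
      using functional_bound_large[OF 2(1) x1 _ _ C1 C2, of "1/5"] by (simp add: field_simps)
    ultimately show ?thesis by simp
  next
    case 3
    let ?g = "\<lambda>x::real. 9/100 + (1 - x^2 - 3/4 * x^4) * (5/9) + 5/6 * x^3"
    have "?g x \<le> ?g (19/25)"
    proof (rule DERIV_nonpos_imp_nonincreasing[OF 3])
      fix t :: real assume t: "19/25 \<le> t" "t \<le> x"
      have "(?g has_real_derivative - 5/9 * t * (3 * (t - 3/4)^2 + 5/16)) (at t)"
        by (auto intro!: derivative_eq_intros simp: field_simps power2_eq_square power3_eq_cube)
      moreover have "- 5/9 * t * (3 * (t - 3/4)^2 + 5/16) \<le> 0"
        using t by (simp add: mult_nonneg_nonneg add_nonneg_nonneg)
      ultimately show "\<exists>y. (?g has_real_derivative y) (at t) \<and> y \<le> 0" by blast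
    qed
    also have "\<dots> \<le> 0.55195" by (simp add: power2_eq_square power3_eq_cube power4_eq_xxxx)
    finally have "?g x \<le> 0.55195" .
    moreover have "norm (w + x * y + x^3/3) \<le> ?g x"
      using functional_bound_large[OF _ x1 _ _ C1 C2, of "9/50"] 3 by (simp add: field_simps)
    ultimately show ?thesis by linarith
  qed
qed

text \<open>Rotating \<open>f\<close> multiplies \<open>x\<close>, \<open>y\<close>,
  \<open>w\<close> by the first, second and third power of a unimodular number. Constraints and
  functional respect these weights, so \<open>x\<close> may be taken real and nonnegative.\<close>

lemma functional_bound:
  fixes x y w :: complex
  assumes C1: "(norm x)^2 + 3 * (norm y)^2 + 5 * (norm w)^2 \<le> 1"
    and C2: "(norm x)^2 + 3 * (norm (x^2 - y))^2 + 5 * (norm (2 * x^3 - 4 * x * y + w))^2 \<le> 1"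
  shows "norm (w + x * y + x^3/3) \<le> 0.55195"
proof -
  obtain e where e: "norm e = 1" "x = of_real (norm x) * e"
  proof (cases "x = 0")
    case True then show ?thesis using that[of 1] by simp
  next
    case False then show ?thesis using that[of "x / of_real (norm x)"] by (simp add: norm_divide)
  qed
  define r where "r = norm x"
  have e0: "e \<noteq> 0" using e by auto
  have x: "x = of_real r * e" using e(2) by (simp add: r_def)
  define y' w' where "y' = y / e^2" and "w' = w / e^3"
  have y: "y = y' * e^2" and w: "w = w' * e^3" using e0 by (auto simp: y'_def w'_def)
  have n: "norm (a * e^k) = norm a" for a k using e(1) by (simp add: norm_mult norm_power)
  have "norm (w' + r * y' + r^3/3) \<le> 0.55195"
  proof (rule functional_bound_real)
    show "r^2 + 3 * (norm y')^2 + 5 * (norm w')^2 \<le> 1"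
      using C1 unfolding y w n by (simp add: r_def)
    have "x^2 - y = (r^2 - y') * e^2" "2 * x^3 - 4 * x * y + w = (2 * r^3 - 4 * r * y' + w') * e^3"
      by (auto simp: x y w algebra_simps power_mult_distrib power2_eq_square power3_eq_cube)
    then show "r^2 + 3 * (norm (r^2 - y'))^2 + 5 * (norm (2 * r^3 - 4 * r * y' + w'))^2 \<le> 1"
      using C2 by (simp only: n) (simp add: r_def)
  qed (simp add: r_def)
  moreover have "w + x * y + x^3/3 = (w' + r * y' + r^3/3) * e^3"
    by (simp add: x y w algebra_simps power_mult_distrib power2_eq_square power3_eq_cube)
  ultimately show ?thesis by (simp only: n)
qed

section \<open>The area theorem\<close>

lemma circle_mean_value:
  assumes H: "H holomorphic_on ball 0 1" and s: "0 < s" "s < 1"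
  shows "((\<lambda>\<theta>. H (of_real s * cis \<theta>)) has_integral of_real (2 * pi) * H 0) {0..2*pi}"
proof -
  have sub: "cball (0::complex) s \<subseteq> ball 0 1" using s by auto
  have "((\<lambda>u. H u / (u - 0)) has_contour_integral 2 * of_real pi * \<i> * H 0) (circlepath 0 s)"
    using s sub by (intro Cauchy_integral_circlepath holomorphic_on_imp_continuous_on holomorphic_on_subset[OF H]) auto
  then have "((\<lambda>\<theta>. \<i> * H (of_real s * cis \<theta>)) has_integral \<i> * (2 * of_real pi * H 0)) {0..2*pi}"
    unfolding circlepath_def using s
    by (subst (asm) has_contour_integral_part_circlepath_iff) (auto simp: mult_ac)
  from has_integral_mult_right[OF this, of "-\<i>"] show ?thesis
    by simp
qed

text \<open>One step of Taylor division. It drives the induction for Bessel's inequality, and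
  applied twice it isolates the linear term of \<open>h\<close> in the area theorem.\<close>

lemma holomorphic_on_ball_shift:
  assumes H: "H holomorphic_on ball 0 1"
  obtains K where "K holomorphic_on ball 0 1" "\<And>z. z \<in> ball 0 1 \<Longrightarrow> H z = H 0 + z * K z"
    "\<And>n. fps_nth (fps_expansion K 0) n = fps_nth (fps_expansion H 0) (Suc n)"
proof -
  define K where "K = (\<lambda>z. if z = 0 then deriv H 0 else (H z - H 0) / z)"
  have "(H has_field_derivative deriv H 0) (at 0)"
    using H holomorphic_derivI[OF H open_ball, of 0] by simp
  then have d: "deriv (\<lambda>z. H z - H 0) 0 = deriv H 0"
    by (intro DERIV_imp_deriv) (auto intro!: derivative_eq_intros)
  have K: "K holomorphic_on ball 0 1"
    by (rule pole_theorem_0[of "\<lambda>z. H z - H 0" _ 0]) (use H d in \<open>auto simp: K_def intro!: holomorphic_intros\<close>)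
  have eq: "H z = H 0 + z * K z" for z by (auto simp: K_def)
  have "(\<lambda>z. H 0 + z * K z) has_fps_expansion fps_const (H 0) + fps_X * fps_expansion K 0"
    by (intro fps_expansion_intros has_fps_expansion_fps_expansion[of "ball 0 1"] K) auto
  moreover have "H has_fps_expansion fps_expansion H 0"
    by (intro has_fps_expansion_fps_expansion[of "ball 0 1"] H) auto
  ultimately have "fps_expansion H 0 = fps_const (H 0) + fps_X * fps_expansion K 0"
    using fps_expansion_unique_complex eq by (metis (no_types, lifting) ext)
  then have "fps_nth (fps_expansion K 0) n = fps_nth (fps_expansion H 0) (Suc n)" for n
    by simp
  with K eq that show ?thesis by blast
qed

text \<open>Each induction step splits off \<open>H 0\<close>: the remainder \<open>z * K z\<close>
  vanishes at 0, so by the mean value property the cross term integrates to zero. Finite sums avoid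
  exchanging a series with the integral.\<close>

lemma circle_Bessel_inequality:
  assumes "H holomorphic_on ball 0 1" and s: "0 < s" "s < 1"
  shows "2 * pi * (\<Sum>n<N. (norm (fps_nth (fps_expansion H 0) n))^2 * s^(2*n))
    \<le> integral {0..2*pi} (\<lambda>\<theta>. (norm (H (of_real s * cis \<theta>)))^2)"
  using assms(1)
proof (induction N arbitrary: H)
  case 0
  have "continuous_on {0..2*pi} (\<lambda>\<theta>. H (of_real s * cis \<theta>))"
    using s by (intro continuous_on_compose2[OF holomorphic_on_imp_continuous_on[OF 0]] continuous_intros)
      (auto simp: norm_mult)
  then show ?case
    by (simp add: integral_nonneg integrable_continuous_real continuous_on_norm continuous_on_power)
next
  case (Suc N)
  obtain K where K: "K holomorphic_on ball 0 1" "\<And>z. z \<in> ball 0 1 \<Longrightarrow> H z = H 0 + z * K z"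
    and Kn: "\<And>n. fps_nth (fps_expansion K 0) n = fps_nth (fps_expansion H 0) (Suc n)"
    using holomorphic_on_ball_shift[OF Suc.prems] by blast
  have c: "continuous_on {0..2*pi} (\<lambda>\<theta>. K (of_real s * cis \<theta>))"
    using s by (intro continuous_on_compose2[OF holomorphic_on_imp_continuous_on[OF K(1)]] continuous_intros)
      (auto simp: norm_mult)
  have "((\<lambda>\<theta>. cnj (H 0) * (of_real s * cis \<theta> * K (of_real s * cis \<theta>))) has_integral 0) {0..2*pi}"
    using has_integral_mult_right[OF circle_mean_value[of "\<lambda>z. z * K z", OF _ s], of "cnj (H 0)"] K(1)
    by (simp add: holomorphic_intros)
  from has_integral_mult_right[OF has_integral_Re[OF this], of 2]
  have i1: "((\<lambda>\<theta>. 2 * Re (cnj (H 0) * (of_real s * cis \<theta> * K (of_real s * cis \<theta>)))) has_integral 0) {0..2*pi}"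
    by (simp only: zero_complex.sel mult_zero_right)
  have i2: "((\<lambda>\<theta>. s^2 * (norm (K (of_real s * cis \<theta>)))^2) has_integral
      s^2 * integral {0..2*pi} (\<lambda>\<theta>. (norm (K (of_real s * cis \<theta>)))^2)) {0..2*pi}"
    by (intro has_integral_mult_right integrable_integral integrable_continuous_real continuous_intros c)
  have i0: "((\<lambda>\<theta>. (norm (H 0))^2) has_integral 2 * pi * (norm (H 0))^2) {0..2*pi}"
    using has_integral_const_real[of "(norm (H 0))^2" 0 "2*pi"] by simp
  have eq: "(norm (H (of_real s * cis \<theta>)))^2 = (norm (H 0))^2 +
      2 * Re (cnj (H 0) * (of_real s * cis \<theta> * K (of_real s * cis \<theta>))) + s^2 * (norm (K (of_real s * cis \<theta>)))^2" for \<theta>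
  proof -
    have "H (of_real s * cis \<theta>) = H 0 + of_real s * cis \<theta> * K (of_real s * cis \<theta>)"
      using s by (intro K(2)) (simp add: norm_mult)
    moreover have "(norm (a + b))^2 = (norm a)^2 + 2 * Re (cnj a * b) + (norm b)^2" for a b :: complex
      by (simp only: cmod_power2) (simp add: power2_eq_square algebra_simps)
    ultimately show ?thesis by (simp add: norm_mult power_mult_distrib)
  qed
  have "integral {0..2*pi} (\<lambda>\<theta>. (norm (H (of_real s * cis \<theta>)))^2) =
     2 * pi * (norm (H 0))^2 + 0 + s^2 * integral {0..2*pi} (\<lambda>\<theta>. (norm (K (of_real s * cis \<theta>)))^2)"
    unfolding eq by (intro integral_unique has_integral_add i0 i1 i2)
  moreover have "2 * pi * (\<Sum>n<Suc N. (norm (fps_nth (fps_expansion H 0) n))^2 * s^(2*n)) =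
     2 * pi * (norm (H 0))^2 + s^2 * (2 * pi * (\<Sum>n<N. (norm (fps_nth (fps_expansion K 0) n))^2 * s^(2*n)))"
    unfolding sum.lessThan_Suc_shift Kn
    by (simp add: algebra_simps sum_distrib_left fps_expansion_def power2_eq_square)
  ultimately show ?case
    using Suc.IH[OF K(1)] by (simp add: mult_left_mono)
qed

section \<open>Location and area of sheared images\<close>

text \<open>The change of variables below takes place on \<open>real^2\<close>, the iterated
  integral on pairs; identifying coordinates preserves the content of boxes.\<close>

lemma has_integral_vec2:
  fixes f :: "real^2 \<Rightarrow> real"
  assumes "(f has_integral i) (cbox a b)"
  shows "((\<lambda>p. f (vector [fst p, snd p])) has_integral i) (cbox ((vec_nth a 1), (vec_nth a 2)) ((vec_nth b 1), (vec_nth b 2)))"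
proof -
  let ?g = "\<lambda>p::real\<times>real. vector [fst p, snd p] :: real^2"
  let ?h = "\<lambda>v::real^2. ((vec_nth v 1), (vec_nth v 2))"
  have g: "?g ` cbox u v = cbox (?g u) (?g v)" for u v
  proof -
    have "x \<in> ?g ` cbox u v" if "x \<in> cbox (?g u) (?g v)" for x
      using that by (intro image_eqI[of _ _ "?h x"])
        (cases u; cases v; auto simp: mem_box_cart forall_2 vec_eq_iff)+
    moreover have "?g p \<in> cbox (?g u) (?g v)" if "p \<in> cbox u v" for p
      using that by (cases u; cases v; cases p; auto simp: mem_box_cart forall_2)
    ultimately show ?thesis by blast
  qed
  have h: "?h ` cbox u v = cbox (?h u) (?h v)" for u v
  proof -
    have "p \<in> ?h ` cbox u v" if "p \<in> cbox (?h u) (?h v)" for p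
      using that by (intro image_eqI[of _ _ "?g p"]) (cases p; auto simp: mem_box_cart forall_2)+
    then show ?thesis by (auto simp: mem_box_cart)
  qed
  have "((\<lambda>x. f (?g x)) has_integral (1 / 1) *\<^sub>R i) (?h ` cbox a b)"
  proof (rule has_integral_twiddle[OF _ _ _ _ _ _ _ assms])
    show "continuous (at x) ?g" for x
      unfolding continuous_at by (rule vec_tendstoI) (auto simp: vector_def forall_2 intro!: tendsto_eq_intros)
    show "measure lborel (?g ` cbox u v) = 1 * measure lborel (cbox u v)" for u v
    proof -
      have ex2: "(\<exists>i::2. Q i) \<longleftrightarrow> Q 1 \<or> Q 2" for Q by (metis exhaust_2)
      obtain u1 u2 v1 v2 where uv: "u = (u1,u2)" "v = (v1,v2)" by fastforce
      show ?thesis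
        unfolding g by (simp add: uv content_Pair content_cbox_if_cart UNIV_2 interval_eq_empty_cart ex2)
    qed
  qed (auto simp: g h vec_eq_iff forall_2)
  then show ?thesis by (simp add: h)
qed

text \<open>For \<open>norm k < 1\<close> this makes the shear injective and the region it maps into
  a disc bounded; both consequences are used.\<close>

lemma shear_lower_bound:
  fixes k w :: complex
  shows "(1 - norm k) * norm w \<le> norm (w - k * cnj w)"
proof -
  have "norm w - norm (k * cnj w) \<le> norm (w - k * cnj w)" by (rule norm_triangle_ineq2)
  then show ?thesis by (simp add: norm_mult algebra_simps)
qed

text \<open>
  The exterior of the ellipse is connected and meets the image of the punctured disc of radius \<open>r\<close>
  but not its frontier; hence that image contains it, and by injectivity no other point maps there.
\<close>
lemma exterior_containment:
  fixes F :: "complex \<Rightarrow> complex"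
  assumes hol: "F holomorphic_on ball 0 1 - {0}" and inj: "inj_on F (ball 0 1 - {0})"
    and pole: "filterlim F at_infinity (at 0)"
    and r: "0 < r" "r < 1" and k: "norm k < 1"
    and bd: "\<And>z. norm z = r \<Longrightarrow> norm (F z - k * cnj (F z)) \<le> M"
    and z0: "r < norm z0" "norm z0 < 1"
  shows "norm (F z0 - k * cnj (F z0)) \<le> M"
proof (rule ccontr)
  define S where "S = {w. norm (w - k * cnj w) \<le> M}"
  define V where "V = F ` (ball 0 r - {0})"
  assume "\<not> ?thesis"
  then have z0S: "F z0 \<in> - S" by (simp add: S_def)
  have far: "\<exists>\<delta>>0. \<forall>z. z \<noteq> 0 \<and> norm z < \<delta> \<longrightarrow> B < norm (F z)" for B
  proof -
    have "\<forall>\<^sub>F z in at 0. B < norm (F z)"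
      using filterlim_at_infinity_imp_norm_at_top[OF pole] by (simp add: filterlim_at_top_dense)
    then show ?thesis by (auto simp: eventually_at dist_norm)
  qed
  have bS: "bounded S"
  proof (rule boundedI)
    fix w assume "w \<in> S"
    then have "(1 - norm k) * norm w \<le> M" using shear_lower_bound[of k w] by (simp add: S_def)
    then show "norm w \<le> M / (1 - norm k)" using k by (simp add: field_simps)
  qed
  have "linear (\<lambda>w. w - k * cnj w)"
    by (rule linearI) (auto simp: algebra_simps scaleR_conv_of_real)
  moreover have "S = (\<lambda>w. w - k * cnj w) -` cball 0 M" by (auto simp: S_def)
  ultimately have "convex S" by (simp add: convex_linear_vimage)
  with bS have conn: "connected (- S)" by (intro connected_complement_bounded_convex) auto
  have sub: "ball 0 r - {0} \<subseteq> ball (0::complex) 1 - {0}" using r by auto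
  have oV: "open V" unfolding V_def
    by (intro invariance_of_domain holomorphic_on_imp_continuous_on holomorphic_on_subset[OF hol sub]
      inj_on_subset[OF inj sub]) auto
  obtain B where B: "\<And>w. w \<in> S \<Longrightarrow> norm w \<le> B" using bS bounded_iff by blast
  obtain \<delta> where \<delta>: "\<delta> > 0" "\<And>z. z \<noteq> 0 \<Longrightarrow> norm z < \<delta> \<Longrightarrow> B < norm (F z)" using far[of B] by blast
  define z1 :: complex where "z1 = of_real (min \<delta> r / 2)"
  have z1: "z1 \<noteq> 0" "norm z1 < \<delta>" "norm z1 < r" using \<delta>(1) r by (auto simp: z1_def)
  \<comment> \<open>Close to the pole \<open>F\<close> leaves the bounded set \<open>S\<close>, so
    the exterior meets \<open>V\<close>.\<close>
  have "F z1 \<in> - S \<inter> V" using B \<delta>(2)[OF z1(1,2)] z1 by (force simp: V_def)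
  moreover have "F z0 \<in> - S - V"
    using z0S z0 r inj by (auto simp: V_def dest!: inj_onD)
  ultimately obtain w where w: "w \<notin> S" "w \<in> frontier V"
    using connected_Int_frontier[OF conn, of V] by blast
  then have wV: "w \<in> closure V" "w \<notin> V" using oV by (auto simp: frontier_def interior_open)
  \<comment> \<open>Near 0 the values of \<open>F\<close> stay away from \<open>w\<close>, so
    \<open>w\<close> is a limit of values on a compact annulus and therefore itself such a
    value.\<close>
  obtain \<epsilon> where \<epsilon>: "\<epsilon> > 0" "\<And>z. z \<noteq> 0 \<Longrightarrow> norm z < \<epsilon> \<Longrightarrow> norm w + 1 < norm (F z)" using far by blast
  have "V \<subseteq> F ` (cball 0 r - ball 0 \<epsilon>) \<union> {u. norm w + 1 \<le> norm u}"
    using \<epsilon>(2) by (fastforce simp: V_def not_less)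
  moreover have "closed (F ` (cball 0 r - ball 0 \<epsilon>) \<union> {u. norm w + 1 \<le> norm u})"
    using r \<epsilon>(1) by (intro closed_Un compact_imp_closed compact_continuous_image compact_diff
        holomorphic_on_imp_continuous_on holomorphic_on_subset[OF hol] closed_Collect_le continuous_intros) auto
  ultimately have "w \<in> F ` (cball 0 r - ball 0 \<epsilon>) \<union> {u. norm w + 1 \<le> norm u}"
    using wV(1) closure_minimal by blast
  then obtain z where z: "w = F z" "norm z \<le> r" "\<epsilon> \<le> norm z" by auto
  show False
  proof (cases "norm z = r")
    case True then show False using bd[OF True] w(1) z(1) by (simp add: S_def)
  next
    case False then show False using z wV(2) \<epsilon>(1) by (auto simp: V_def)
  qed
qed

text \<open>Change of variables for polar coordinates, then \<open>F\<close>, then the shear. The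
  Jacobian is the product of the radius, \<open>|F'|^2\<close> and the determinant
  \<open>1 - |k|^2\<close> of the shear, and the image lies in a disc of area
  \<open>pi * M^2\<close>.\<close>

lemma sheared_image_area_le:
  fixes F F' :: "complex \<Rightarrow> complex"
  assumes r: "0 < r" "r < \<rho>" and k: "norm k < 1" and M: "0 \<le> M"
    and der: "\<And>z. r < norm z \<Longrightarrow> norm z < \<rho> \<Longrightarrow> (F has_field_derivative F' z) (at z)"
    and cont: "continuous_on {z. r \<le> norm z \<and> norm z \<le> \<rho>} F'"
    and inj: "inj_on F {z. r < norm z \<and> norm z < \<rho>}"
    and bd: "\<And>z. r < norm z \<Longrightarrow> norm z < \<rho> \<Longrightarrow> norm (F z - k * cnj (F z)) \<le> M"
  shows "(1 - (norm k)^2) * integral {r..\<rho>} (\<lambda>s. integral {0..2*pi} (\<lambda>\<theta>. s * (norm (F' (of_real s * cis \<theta>)))^2))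
     \<le> pi * M^2"
proof -
  define T :: "complex \<Rightarrow> real^2" where "T = (\<lambda>w. vector [Re (w - k * cnj w), Im (w - k * cnj w)])"
  define P :: "real^2 \<Rightarrow> complex" where "P = (\<lambda>v. of_real (vec_nth v 1) * exp (\<i> * of_real (vec_nth v 2)))"
  define D where "D = (\<lambda>v (h :: real^2). T (F' (P v) * (of_real (vec_nth v 1) * (exp (\<i> * of_real (vec_nth v 2)) * (\<i> * of_real (vec_nth h 2)))
      + of_real (vec_nth h 1) * exp (\<i> * of_real (vec_nth v 2)))))"
  define a b :: "real^2" where "a = vector [r, 0]" and "b = vector [\<rho>, 2*pi]"
  define J where "J = (\<lambda>v. (1 - (norm k)^2) * ((vec_nth v 1) * (norm (F' (P v)))^2))"
  have k2: "(norm k)^2 < 1" using k by (simp add: abs_square_less_1)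
  have nP: "norm (P v) = \<bar>(vec_nth v 1)\<bar>" for v by (simp add: P_def norm_mult)
  have inbox: "r < (vec_nth v 1)" "(vec_nth v 1) < \<rho>" "0 < (vec_nth v 2)" "(vec_nth v 2) < 2*pi" if "v \<in> box a b" for v
    using that by (auto simp: mem_box_cart forall_2 a_def b_def)
  have incbox: "r \<le> \<bar>vec_nth v 1\<bar>" "\<bar>vec_nth v 1\<bar> \<le> \<rho>" if "v \<in> cbox a b" for v
    using that r by (auto simp: mem_box_cart forall_2 a_def b_def)
  have linT: "bounded_linear T"
  proof (rule linear_conv_bounded_linear[THEN iffD1], rule linearI)
    show "T (x + y) = T x + T y" for x y
      by (simp add: T_def vec_eq_iff forall_2 algebra_simps)
    show "T (c *\<^sub>R x) = c *\<^sub>R T x" for c x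
      by (simp add: T_def vec_eq_iff forall_2 algebra_simps)
  qed
  have injT: "w = w'" if "T w = T w'" for w w'
  proof -
    have eq0: "(w - w') - k * cnj (w - w') = 0"
      using that by (auto simp: T_def vec_eq_iff forall_2 complex_eq_iff algebra_simps)
    have "(1 - norm k) * norm (w - w') \<le> 0" using shear_lower_bound[of k "w - w'"] unfolding eq0 by simp
    then show ?thesis using k by (simp add: mult_le_0_iff)
  qed
  have normT: "norm (T w) = norm (w - k * cnj w)" for w
    by (simp add: T_def norm_vec_def L2_set_def sum_2 cmod_def)
  have derP: "(P has_derivative (\<lambda>h. of_real (vec_nth v 1) * (exp (\<i> * of_real (vec_nth v 2)) * (\<i> * of_real (vec_nth h 2)))
      + of_real (vec_nth h 1) * exp (\<i> * of_real (vec_nth v 2)))) (at v)" for v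
  proof -
    have l: "((\<lambda>v::real^2. of_real (vec_nth v i) :: complex) has_derivative (\<lambda>h. of_real (vec_nth h i))) (at v)" for i
      by (intro bounded_linear_imp_has_derivative bounded_linear_of_real[THEN bounded_linear_compose] bounded_linear_vec_nth)
    have "((\<lambda>v::real^2. exp (\<i> * of_real (vec_nth v 2))) has_derivative
        (\<lambda>h. exp (\<i> * of_real (vec_nth v 2)) * (\<i> * of_real (vec_nth h 2)))) (at v)"
      by (rule has_derivative_compose[of "\<lambda>v::real^2. \<i> * of_real (vec_nth v 2)", OF has_derivative_mult_right[OF l]
          DERIV_exp[unfolded has_field_derivative_def]])
    from has_derivative_mult[OF l this] show ?thesis unfolding P_def .
  qed
  have derF: "((\<lambda>v. T (F (P v))) has_derivative D v) (at v within box a b)" if "v \<in> box a b" for v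
  proof -
    have "(F has_derivative (\<lambda>h. F' (P v) * h)) (at (P v))"
      using der[of "P v"] inbox[OF that] r unfolding has_field_derivative_def by (simp add: nP)
    from bounded_linear.has_derivative[OF linT has_derivative_compose[OF derP this]]
    show ?thesis unfolding D_def by (rule has_derivative_at_withinI)
  qed
  \<comment> \<open>The open box keeps the angle strictly between 0 and \<open>2*pi\<close>, so it
    is recovered from its exponential.\<close>
  have injF: "inj_on (\<lambda>v. T (F (P v))) (box a b)"
  proof (rule inj_onI)
    fix u v assume uv: "u \<in> box a b" "v \<in> box a b" "T (F (P u)) = T (F (P v))"
    have "P u = P v"
      using inj_onD[OF inj injT[OF uv(3)]] inbox[OF uv(1)] inbox[OF uv(2)] r by (simp add: nP)
    moreover from this have e1: "(vec_nth u 1) = (vec_nth v 1)"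
      using nP[of u] nP[of v] inbox[OF uv(1)] inbox[OF uv(2)] r by simp
    ultimately have "exp (\<i> * of_real (vec_nth u 2)) = exp (\<i> * of_real (vec_nth v 2))"
      using inbox[OF uv(1)] r by (simp add: P_def)
    then have "\<i> * of_real (vec_nth u 2) = \<i> * of_real (vec_nth v 2)"
      by (rule exp_complex_eqI[rotated]) (use inbox[OF uv(1)] inbox[OF uv(2)] in simp)
    then have "(vec_nth u 2) = (vec_nth v 2)" by simp
    with e1 show "u = v" by (simp add: vec_eq_iff forall_2)
  qed
  have detD: "\<bar>det (matrix (D v))\<bar> = J v" if "0 \<le> (vec_nth v 1)" for v
  proof -
    define \<alpha> where "\<alpha> = F' (P v) * exp (\<i> * of_real (vec_nth v 2))"
    have c1: "D v (axis 1 1) = T \<alpha>" and c2: "D v (axis 2 1) = T (\<i> * of_real (vec_nth v 1) * \<alpha>)"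
      by (auto simp: D_def \<alpha>_def axis_def mult_ac)
    have "det (matrix (D v)) = (vec_nth v 1) * (1 - (norm k)^2) * (norm \<alpha>)^2"
      unfolding det_2 matrix_def by (simp only: vec_lambda_beta c1 c2)
        (simp add: T_def cmod_power2, simp add: power2_eq_square algebra_simps)
    also have "norm \<alpha> = norm (F' (P v))" by (simp add: \<alpha>_def norm_mult)
    finally show ?thesis using that k2 by (simp add: J_def abs_mult)
  qed
  have contP: "continuous_on A P" for A unfolding P_def by (intro continuous_intros)
  have contJ: "continuous_on (cbox a b) J"
    unfolding J_def using incbox r
    by (intro continuous_intros continuous_on_compose2[OF cont contP]) (auto simp: nP)
  have eqJ: "integral (box a b) (\<lambda>v. \<bar>det (matrix (D v))\<bar>) = integral (cbox a b) J"
    "(\<lambda>v. \<bar>det (matrix (D v))\<bar>) integrable_on box a b"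
  proof -
    have d: "\<bar>det (matrix (D v))\<bar> = J v" if "v \<in> box a b" for v
      using detD inbox(1)[OF that] r by simp
    have "J integrable_on box a b" using integrable_continuous[OF contJ]
      by (simp add: integrable_on_open_interval)
    then show "(\<lambda>v. \<bar>det (matrix (D v))\<bar>) integrable_on box a b"
      by (rule integrable_eq) (simp add: d)
    show "integral (box a b) (\<lambda>v. \<bar>det (matrix (D v))\<bar>) = integral (cbox a b) J"
      unfolding integral_open_interval[symmetric] by (rule integral_cong) (rule d)
  qed
  have "integral (cbox a b) J = measure lebesgue ((\<lambda>v. T (F (P v))) ` box a b)"
    unfolding eqJ(1)[symmetric] by (rule measure_differentiable_image_eq[symmetric, OF _ derF injF eqJ(2)]) auto
  also have "\<dots> \<le> measure lebesgue (cball (0::real^2) M)"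
  proof (rule measure_mono_fmeasurable)
    show "(\<lambda>v. T (F (P v))) ` box a b \<subseteq> cball 0 M"
    proof clarify
      fix v assume v: "v \<in> box a b"
      show "T (F (P v)) \<in> cball 0 M"
        using bd[of "P v"] inbox[OF v] r by (simp add: normT nP)
    qed
    show "(\<lambda>v. T (F (P v))) ` box a b \<in> sets lebesgue"
      using measurable_differentiable_image_eq[OF _ derF injF] eqJ(2) by (auto dest: fmeasurableD)
  qed auto
  also have "\<dots> = pi * M^2"
    using content_cball[of M "0::real^2"] M by (simp add: unit_ball_vol_2 measure_completion)
  finally have le: "integral (cbox a b) J \<le> pi * M^2" .
  have "((\<lambda>p. J (vector [fst p, snd p])) has_integral integral (cbox a b) J) (cbox (r, 0) (\<rho>, 2*pi))"
    using has_integral_vec2[OF integrable_integral[OF integrable_continuous[OF contJ]]]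
    by (simp add: a_def b_def)
  then have "integral (cbox a b) J = integral (cbox (r, 0) (\<rho>, 2*pi)) (\<lambda>p. J (vector [fst p, snd p]))"
    by (simp add: integral_unique)
  also have "\<dots> = integral (cbox r \<rho>) (\<lambda>s. integral (cbox 0 (2*pi)) (\<lambda>\<theta>. J (vector [fst (s,\<theta>), snd (s,\<theta>)])))"
  proof (rule integral_prod_continuous)
    show "continuous_on (cbox (r, 0) (\<rho>, 2*pi)) (\<lambda>p. J (vector [fst p, snd p]))"
      unfolding J_def P_def using r
      by (auto intro!: continuous_intros continuous_on_compose2[OF cont] simp: cbox_Pair_eq norm_mult)
  qed
  also have "\<dots> = (1 - (norm k)^2) * integral {r..\<rho>} (\<lambda>s. integral {0..2*pi} (\<lambda>\<theta>. s * (norm (F' (of_real s * cis \<theta>)))^2))"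
    by (simp add: J_def P_def cis_conv_exp)
  finally show ?thesis using le by simp
qed

section \<open>From annuli to the area theorem\<close>

lemma fps_expansion_square_mult_deriv:
  assumes h: "h holomorphic_on ball 0 1"
  shows "fps_expansion (\<lambda>z. z^2 * deriv h z - 1) 0 = fps_X^2 * fps_deriv (fps_expansion h 0) - 1"
proof -
  have "(\<lambda>z. z^2 * deriv h z - 1) has_fps_expansion fps_X^2 * fps_deriv (fps_expansion h 0) - 1"
    by (intro fps_expansion_intros has_fps_expansion_fps_expansion[of "ball 0 1"] h) auto
  moreover have "(\<lambda>z. z^2 * deriv h z - 1) has_fps_expansion fps_expansion (\<lambda>z. z^2 * deriv h z - 1) 0"
    by (intro has_fps_expansion_fps_expansion[of "ball 0 1"] holomorphic_intros h) auto
  ultimately show ?thesis using fps_expansion_unique_complex by metis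
qed

text \<open>Multiplying \<open>F'\<close> by \<open>z^2\<close> removes the pole and gives the
  holomorphic \<open>H\<close>, so Bessel's inequality bounds the integral over each circle below by
  \<open>l s\<close>. Integrating \<open>l\<close> through its primitive \<open>\<Lambda>\<close>
  yields the left side up to a factor \<open>pi\<close>.\<close>

lemma area_inequality_annulus:
  fixes h :: "complex \<Rightarrow> complex" and N :: nat
  defines "Q \<equiv> \<lambda>s::real. \<Sum>j<N. real (Suc j) * (norm (fps_nth (fps_expansion h 0) (Suc j)))^2 * s^(2 * Suc j)"
  assumes h: "h holomorphic_on ball 0 1" and inj: "inj_on (\<lambda>z. 1/z + h z) (ball 0 1 - {0})"
    and r: "0 < r" "r < \<rho>" "\<rho> < 1" and k: "norm k < 1"
    and bd: "\<And>z. norm z = r \<Longrightarrow> norm ((1/z + h z) - k * cnj (1/z + h z)) \<le> M"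
  shows "(1 - (norm k)^2) * (1/r^2 - 1/\<rho>^2 + Q \<rho> - Q r) \<le> M^2"
proof -
  define F F' where "F = (\<lambda>z. 1/z + h z)" and "F' = (\<lambda>z. deriv h z - 1/z^2)"
  define H where "H = (\<lambda>z. z^2 * deriv h z - 1)"
  define b where "b = (\<lambda>n. fps_nth (fps_expansion h 0) n)"
  define \<Lambda> where "\<Lambda> = (\<lambda>s. pi * (Q s - 1/s^2))"
  define l where "l = (\<lambda>s. 2 * pi * (1/s^3 + (\<Sum>j<N. (real (Suc j))^2 * (norm (b (Suc j)))^2 * s^(2*j+1))))"
  have M: "0 \<le> M" using bd[of "of_real r"] r norm_ge_zero order_trans by (metis abs_of_pos norm_of_real)
  have k2: "(norm k)^2 < 1" using k by (simp add: abs_square_less_1)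
  have Hh: "H holomorphic_on ball 0 1" unfolding H_def by (intro holomorphic_intros h) auto
  have dF: "(F has_field_derivative F' z) (at z)" if "r < norm z" "norm z < \<rho>" for z
  proof -
    have "z \<noteq> 0" using that r by auto
    moreover have "(h has_field_derivative deriv h z) (at z)"
      using h that r by (intro holomorphic_derivI[OF h open_ball]) auto
    ultimately show ?thesis unfolding F_def F'_def
      by (auto intro!: derivative_eq_intros simp: power2_eq_square)
  qed
  have hF: "F holomorphic_on ball 0 1 - {0}"
    unfolding F_def by (intro holomorphic_intros holomorphic_on_subset[OF h]) auto
  have cF: "continuous_on {z. r \<le> norm z \<and> norm z \<le> \<rho>} F'"
    unfolding F'_def using r
    by (intro continuous_intros continuous_on_subset[OF holomorphic_on_imp_continuous_on[OF holomorphic_deriv[OF h open_ball]]]) auto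
  have pole: "filterlim F at_infinity (at 0)"
  proof -
    have "isCont h 0" using holomorphic_on_imp_continuous_on[OF h] by (simp add: continuous_on_eq_continuous_at)
    then have "(h \<longlongrightarrow> h 0) (at 0)" by (simp add: isCont_def)
    moreover have "filterlim (\<lambda>z::complex. 1/z) at_infinity (at 0)"
      using filterlim_inverse_at_infinity by (simp add: divide_inverse)
    ultimately show ?thesis unfolding F_def by (rule tendsto_add_filterlim_at_infinity'[rotated])
  qed
  have bd': "norm (F z - k * cnj (F z)) \<le> M" if "norm z = r" for z
    unfolding F_def using that by (rule bd)
  have bdF: "norm (F z - k * cnj (F z)) \<le> M" if "r < norm z" "norm z < \<rho>" for z
    by (rule exterior_containment[OF hF inj[folded F_def] pole r(1) _ k bd']) (use that r in auto)
  have area: "(1 - (norm k)^2) * integral {r..\<rho>} (\<lambda>s. integral {0..2*pi} (\<lambda>\<theta>. s * (norm (F' (of_real s * cis \<theta>)))^2))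
     \<le> pi * M^2"
    by (rule sheared_image_area_le[OF r(1,2) k M dF cF _ bdF]) (use r in \<open>auto intro: inj_on_subset[OF inj[folded F_def]]\<close>)
  \<comment> \<open>\<open>H\<close> starts with \<open>-1\<close> and has no linear term, so
    \<open>N + 2\<close> of its coefficients account for \<open>N\<close> coefficients of
    \<open>h\<close>.\<close>
  have coeff: "(\<Sum>n<Suc (Suc N). (norm (fps_nth (fps_expansion H 0) n))^2 * s^(2*n))
      = 1 + (\<Sum>j<N. (real (Suc j))^2 * (norm (b (Suc j)))^2 * s^(2*j+4))" for s :: real
  proof -
    have "fps_nth (fps_expansion H 0) 0 = -1" "fps_nth (fps_expansion H 0) (Suc 0) = 0"
      "fps_nth (fps_expansion H 0) (Suc (Suc j)) = of_nat (Suc j) * b (Suc j)" for j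
      unfolding H_def fps_expansion_square_mult_deriv[OF h] b_def
      by (simp_all only: fps_sub_nth fps_X_power_mult_nth fps_deriv_nth) simp_all
    then show ?thesis
      unfolding sum.lessThan_Suc_shift
      by (simp only: norm_mult norm_of_nat power_mult_distrib) (simp add: eval_nat_numeral)
  qed
  have inner: "l s \<le> integral {0..2*pi} (\<lambda>\<theta>. s * (norm (F' (of_real s * cis \<theta>)))^2)" if s: "r \<le> s" "s \<le> \<rho>" for s
  proof -
    have s0: "0 < s" "s < 1" using s r by auto
    have "F' (of_real s * cis \<theta>) = H (of_real s * cis \<theta>) / (of_real s * cis \<theta>)^2" for \<theta>
      using s0 by (simp add: F'_def H_def field_simps)
    then have "s * (norm (F' (of_real s * cis \<theta>)))^2 = (1/s^3) * (norm (H (of_real s * cis \<theta>)))^2" for \<theta>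
      using s0 by (simp add: norm_divide norm_mult norm_power power_divide power2_eq_square power3_eq_cube)
    then have "integral {0..2*pi} (\<lambda>\<theta>. s * (norm (F' (of_real s * cis \<theta>)))^2) =
       (1/s^3) * integral {0..2*pi} (\<lambda>\<theta>. (norm (H (of_real s * cis \<theta>)))^2)"
      by simp
    also have "\<dots> \<ge> (1/s^3) * (2 * pi * (\<Sum>n<Suc (Suc N). (norm (fps_nth (fps_expansion H 0) n))^2 * s^(2*n)))"
      using s0 by (intro mult_left_mono circle_Bessel_inequality Hh) auto
    also (xtrans) have "(1/s^3) * (2 * pi * (\<Sum>n<Suc (Suc N). (norm (fps_nth (fps_expansion H 0) n))^2 * s^(2*n))) = l s"
    proof -
      have "s^(2*j+4) = s^3 * s^(2*j+1)" for j
        by (simp add: power_add[symmetric] eval_nat_numeral)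
      then have "(\<Sum>j<N. (real (Suc j))^2 * (norm (b (Suc j)))^2 * s^(2*j+4)) 
          = s^3 * (\<Sum>j<N. (real (Suc j))^2 * (norm (b (Suc j)))^2 * s^(2*j+1))"
        by (simp add: sum_distrib_left mult_ac)
      then show ?thesis unfolding coeff l_def using s0 by (simp add: field_simps)
    qed
    finally show ?thesis .
  qed
  have "(l has_integral (\<Lambda> \<rho> - \<Lambda> r)) {r..\<rho>}"
  proof (rule fundamental_theorem_of_calculus)
    fix s assume "s \<in> {r..\<rho>}"
    then have s: "s > 0" using r by auto
    have "(Q has_real_derivative 2 * (\<Sum>j<N. (real (Suc j))^2 * (norm (b (Suc j)))^2 * s^(2*j+1))) (at s within {r..\<rho>})"
      unfolding Q_def b_def sum_distrib_left
    proof (rule DERIV_sum)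
      fix j
      show "((\<lambda>s. real (Suc j) * (norm (fps_nth (fps_expansion h 0) (Suc j)))^2 * s^(2 * Suc j)) has_real_derivative
          2 * ((real (Suc j))^2 * (norm (fps_nth (fps_expansion h 0) (Suc j)))^2 * s^(2*j+1))) (at s within {r..\<rho>})"
        by (rule DERIV_cong[OF DERIV_cmult[OF DERIV_pow]]) (simp add: power2_eq_square algebra_simps)
    qed
    moreover have "((\<lambda>s. 1/s^2) has_real_derivative - 2/s^3) (at s within {r..\<rho>})"
      using s by (auto intro!: derivative_eq_intros simp: field_simps power2_eq_square power3_eq_cube)
    ultimately have "(\<Lambda> has_real_derivative pi * (2 * (\<Sum>j<N. (real (Suc j))^2 * (norm (b (Suc j)))^2 * s^(2*j+1)) - (- 2/s^3))) (at s within {r..\<rho>})"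
      unfolding \<Lambda>_def by (intro DERIV_cmult DERIV_diff)
    then show "(\<Lambda> has_vector_derivative l s) (at s within {r..\<rho>})"
      unfolding has_real_derivative_iff_has_vector_derivative[symmetric]
      by (rule DERIV_cong) (simp add: l_def algebra_simps)
  qed (use r in auto)
  then have "\<Lambda> \<rho> - \<Lambda> r = integral {r..\<rho>} l" "l integrable_on {r..\<rho>}"
    by (auto simp: integral_unique)
  moreover have "integral {r..\<rho>} l \<le> integral {r..\<rho>} (\<lambda>s. integral {0..2*pi} (\<lambda>\<theta>. s * (norm (F' (of_real s * cis \<theta>)))^2))"
  proof (rule integral_le[OF calculation(2)])
    have "continuous_on (cbox (r, 0) (\<rho>, 2*pi)) (\<lambda>p. fst p * (norm (F' (of_real (fst p) * cis (snd p))))^2)"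
      using r by (auto intro!: continuous_intros continuous_on_compose2[OF cF] simp: cbox_Pair_eq norm_mult)
    then have "(\<lambda>s. integral (cbox 0 (2*pi)) (\<lambda>\<theta>. fst (s,\<theta>) * (norm (F' (of_real (fst (s,\<theta>)) * cis (snd (s,\<theta>)))))^2)) integrable_on cbox r \<rho>"
      by (rule integral_integrable_2dim)
    then show "(\<lambda>s. integral {0..2*pi} (\<lambda>\<theta>. s * (norm (F' (of_real s * cis \<theta>)))^2)) integrable_on {r..\<rho>}"
      by simp
  qed (use inner in auto)
  ultimately have "(1 - (norm k)^2) * (\<Lambda> \<rho> - \<Lambda> r) \<le> pi * M^2"
    using area k2 by (smt (verit) mult_left_mono)
  moreover have "(1 - (norm k)^2) * (\<Lambda> \<rho> - \<Lambda> r) = pi * ((1 - (norm k)^2) * (1/r^2 - 1/\<rho>^2 + Q \<rho> - Q r))"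
    by (simp add: \<Lambda>_def algebra_simps)
  ultimately show ?thesis by simp
qed

text \<open>
  The circle of radius \<open>r\<close> is mapped close to an ellipse, which the shear with \<open>k = h'(0) r\<^sup>2\<close>
  turns into a circle up to an error \<open>O(r\<^sup>2)\<close>. Without the shear the error would be \<open>O(r)\<close>
  and contribute a constant to the area.
\<close>
theorem area_theorem:
  assumes h: "h holomorphic_on ball 0 1" and h0: "h 0 = 0"
    and inj: "inj_on (\<lambda>z. 1/z + h z) (ball 0 1 - {0})"
  shows "(\<Sum>j<N. real (Suc j) * (norm (fps_nth (fps_expansion h 0) (Suc j)))^2) \<le> 1"
proof -
  define Q where "Q = (\<lambda>s::real. \<Sum>j<N. real (Suc j) * (norm (fps_nth (fps_expansion h 0) (Suc j)))^2 * s^(2 * Suc j))"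
  \<comment> \<open>Two divisions give \<open>h z = \<beta> * z + z^2 * G z\<close>.\<close>
  obtain K where K: "K holomorphic_on ball 0 1" "\<And>z. z \<in> ball 0 1 \<Longrightarrow> h z = h 0 + z * K z"
    "\<And>n. fps_nth (fps_expansion K 0) n = fps_nth (fps_expansion h 0) (Suc n)"
    by (rule holomorphic_on_ball_shift[OF h]) (rule that)
  obtain G where G: "G holomorphic_on ball 0 1" "\<And>z. z \<in> ball 0 1 \<Longrightarrow> K z = K 0 + z * G z"
    "\<And>n. fps_nth (fps_expansion G 0) n = fps_nth (fps_expansion K 0) (Suc n)"
    by (rule holomorphic_on_ball_shift[OF K(1)]) (rule that)
  define \<beta> where "\<beta> = K 0"
  have bounded_half: "\<exists>B\<ge>0. \<forall>z. norm z \<le> 1/2 \<longrightarrow> norm (f z) \<le> B" if "f holomorphic_on ball 0 1" for f :: "complex \<Rightarrow> complex"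
  proof -
    have "compact (f ` cball 0 (1/2))"
      by (intro compact_continuous_image holomorphic_on_imp_continuous_on holomorphic_on_subset[OF that]) auto
    then obtain B where "B > 0" "\<forall>x\<in>f ` cball 0 (1/2). norm x \<le> B"
      using compact_imp_bounded bounded_pos by blast
    then show ?thesis by (intro exI[of _ B]) auto
  qed
  obtain B1 B2 where B1: "B1 \<ge> 0" "\<And>z. norm z \<le> 1/2 \<Longrightarrow> norm (h z) \<le> B1"
    and B2: "B2 \<ge> 0" "\<And>z. norm z \<le> 1/2 \<Longrightarrow> norm (G z) \<le> B2"
    using bounded_half[OF h] bounded_half[OF G(1)] by metis
  define C where "C = B2 + norm \<beta> * B1"
  have step: "(1 - (norm \<beta> * r^2)^2) * (1/r^2 - 1/\<rho>^2 + Q \<rho> - Q r) \<le> (1/r + C * r^2)^2"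
    if r: "0 < r" "r \<le> 1/2" "norm \<beta> * r^2 < 1" and \<rho>: "r < \<rho>" "\<rho> < 1" for r \<rho>
  proof -
    have nk: "norm (\<beta> * of_real (r^2)) = norm \<beta> * r^2" by (simp add: norm_mult norm_power)
    have "norm ((1/z + h z) - \<beta> * of_real (r^2) * cnj (1/z + h z)) \<le> 1/r + C * r^2" if z: "norm z = r" for z
    proof -
      have z0: "z \<noteq> 0" using z r by auto
      have "of_real (r^2) = z * cnj z" using complex_norm_square[of z] z by simp
      \<comment> \<open>On this circle the conjugate of the pole term is a multiple of
        \<open>z\<close>, so the shear cancels \<open>\<beta> * z\<close> exactly and leaves terms
        of order \<open>r^2\<close>.\<close>
      then have inv: "of_real (r^2) * cnj (1/z) = z" using z0 by simp
      have hz: "h z = \<beta> * z + z^2 * G z"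
        using K(2)[of z] G(2)[of z] z r h0 by (simp add: \<beta>_def power2_eq_square algebra_simps)
      have "(1/z + h z) - \<beta> * of_real (r^2) * cnj (1/z + h z) = 1/z + (h z - \<beta> * (of_real (r^2) * cnj (1/z))) - \<beta> * of_real (r^2) * cnj (h z)"
        by (simp add: algebra_simps)
      also have "\<dots> = 1/z + z^2 * G z - \<beta> * of_real (r^2) * cnj (h z)"
        unfolding inv hz by (simp add: algebra_simps)
      also have "norm \<dots> \<le> norm (1/z) + norm (z^2 * G z) + norm (\<beta> * of_real (r^2) * cnj (h z))"
        by (meson norm_triangle_ineq norm_triangle_ineq4 order_trans add_right_mono)
      also have "\<dots> = 1/r + r^2 * norm (G z) + norm \<beta> * r^2 * norm (h z)"
        using z by (simp add: norm_mult norm_power norm_divide)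
      also have "\<dots> \<le> 1/r + r^2 * B2 + norm \<beta> * r^2 * B1"
        using B1(2)[of z] B2(2)[of z] z r by (intro add_mono mult_left_mono) auto
      finally show ?thesis by (simp add: C_def algebra_simps)
    qed
    from area_inequality_annulus[OF h inj r(1) \<rho> _ this, where N = N]
    show ?thesis unfolding nk Q_def using r(3) by simp
  qed
  have Q0: "Q 0 = 0" by (simp add: Q_def)
  have contQ: "isCont Q s" for s unfolding Q_def by (intro continuous_intros)
  \<comment> \<open>Both sides of \<open>step\<close> contain \<open>1/r^2\<close>; once it cancels,
    the remaining error terms tend to 0 with \<open>r\<close>.\<close>
  have rho: "Q \<rho> - 1/\<rho>^2 \<le> 0" if \<rho>: "0 < \<rho>" "\<rho> < 1" for \<rho>
  proof (rule tendsto_le[of "at_right 0"])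
    have "(Q \<longlongrightarrow> 0) (at_right 0)" using contQ[of 0] Q0 
      by (metis continuous_within filterlim_at_split isCont_def)
    then show "((\<lambda>r. (1 - (norm \<beta> * r^2)^2) * (Q \<rho> - 1/\<rho>^2 - Q r)) \<longlongrightarrow> Q \<rho> - 1/\<rho>^2) (at_right 0)"
      by (auto intro!: tendsto_eq_intros)
    show "((\<lambda>r. (norm \<beta>)^2 * r^2 + 2 * C * r + C^2 * r^4) \<longlongrightarrow> 0) (at_right 0)"
      by (auto intro!: tendsto_eq_intros)
    have "((\<lambda>r. norm \<beta> * r^2) \<longlongrightarrow> 0) (at_right 0)" by (auto intro!: tendsto_eq_intros)
    then have "\<forall>\<^sub>F r in at_right 0. norm \<beta> * r^2 < 1" by (rule order_tendstoD) simp
    moreover have "\<forall>\<^sub>F r in at_right 0. 0 < r \<and> r < min (1/2) \<rho>"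
      using \<rho> by (auto simp: eventually_at_right_less intro!: eventually_conj eventually_at_right_real
          eventually_at_rightI[of 0 "min (1/2) \<rho>"])
    ultimately show "\<forall>\<^sub>F r in at_right 0. (1 - (norm \<beta> * r^2)^2) * (Q \<rho> - 1/\<rho>^2 - Q r) 
        \<le> (norm \<beta>)^2 * r^2 + 2 * C * r + C^2 * r^4"
    proof eventually_elim
      case (elim r)
      then have r: "r > 0" by simp
      have "(1 - (norm \<beta> * r^2)^2) * (1/r^2 + (Q \<rho> - 1/\<rho>^2 - Q r)) \<le> (1/r + C * r^2)^2"
        using step[of r \<rho>] elim \<rho> by (simp add: algebra_simps)
      moreover have "(1/r + C * r^2)^2 = 1/r^2 + 2 * C * r + C^2 * r^4"
        using r by (simp add: field_simps power2_eq_square power4_eq_xxxx)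
      moreover have "(1 - (norm \<beta> * r^2)^2) * (1/r^2) = 1/r^2 - (norm \<beta>)^2 * r^2"
        using r by (simp add: field_simps power2_eq_square)
      ultimately show ?case by (simp add: distrib_left)
    qed
  qed simp
  have "Q 1 - 1/1^2 \<le> 0"
  proof (rule tendsto_upperbound[of _ _ "at_left 1"])
    have "(Q \<longlongrightarrow> Q 1) (at_left 1)" using contQ[of 1] by (metis filterlim_at_split isCont_def)
    then show "((\<lambda>\<rho>. Q \<rho> - 1/\<rho>^2) \<longlongrightarrow> Q 1 - 1/1^2) (at_left 1)"
      by (auto intro!: tendsto_eq_intros)
    show "\<forall>\<^sub>F \<rho> in at_left 1. Q \<rho> - 1/\<rho>^2 \<le> 0"
      using rho by (intro eventually_at_leftI[of 0]) auto
  qed simp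
  then show ?thesis by (simp add: Q_def)
qed

section \<open>Bi-univalent functions\<close>

text \<open>The coefficient formulas come from \<open>E * E * F = fps_X\<close>, solved degree by
  degree. The area theorem is applied to the regular part of \<open>e (z^2) / z\<close>, where
  \<open>c1\<close>, \<open>c2\<close>, \<open>c3\<close> sit at degrees 1, 3, 5.\<close>

lemma class_S_coeff_area:
  assumes f: "f \<in> class_S" and F: "F = fps_expansion f 0"
  obtains c1 c2 c3 where "fps_nth F 2 = - 2 * c1" "fps_nth F 3 = 3 * c1^2 - 2 * c2"
    "fps_nth F 4 = - 2 * c3 + 6 * c1 * c2 - 4 * c1^3"
    "(norm c1)^2 + 3 * (norm c2)^2 + 5 * (norm c3)^2 \<le> 1"
proof -
  have hol: "f holomorphic_on ball 0 1" and inj: "inj_on f (ball 0 1)" and f0: "f 0 = 0" and f1: "deriv f 0 = 1"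
    using f by (auto simp: class_S_def)
  have L: "log_branch f holomorphic_on ball 0 1" "log_branch f 0 = 0"
    "\<And>z. z \<in> ball 0 1 - {0} \<Longrightarrow> exp (log_branch f z) = f z / z"
    using is_log_branch_log_branch[OF f] by (auto simp: is_log_branch_def)
  define e where "e = (\<lambda>z. exp (- log_branch f z / 2))"
  define E where "E = fps_expansion e 0"
  have e: "e holomorphic_on ball 0 1" unfolding e_def by (intro holomorphic_intros L) auto
  have e0: "e 0 = 1" by (simp add: e_def L)
  have enz: "e z \<noteq> 0" for z by (simp add: e_def)
  have esq: "e z * e z * f z = z" if "z \<in> ball 0 1" for z
  proof (cases "z = 0")
    case False
    then have "f z = z * exp (log_branch f z)" using L(3) that by simp
    moreover have "e z * e z * exp (log_branch f z) = 1"
      by (simp add: e_def exp_add[symmetric])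
    ultimately show ?thesis by (simp add: mult.left_commute)
  qed (simp add: f0)
  have expf: "f has_fps_expansion F" and expe: "e has_fps_expansion E"
    unfolding F E_def by (auto intro!: has_fps_expansion_fps_expansion[of "ball 0 1"] hol e)
  have "\<forall>\<^sub>F z in nhds 0. z \<in> ball (0::complex) 1"
    by (intro eventually_nhds_in_open) auto
  then have "\<forall>\<^sub>F z in nhds 0. e z * e z * f z = z" by (auto elim: eventually_mono simp: esq)
  moreover have "(\<lambda>z. e z * e z * f z) has_fps_expansion E * E * F"
    by (intro fps_expansion_intros expe expf)
  ultimately have EEF: "E * E * F = fps_X"
    using fps_expansion_unique_complex has_fps_expansion_cong has_fps_expansion_fps_X by metis
  define H where "H = E * E"
  have E0: "fps_nth E 0 = 1" by (simp add: E_def fps_expansion_def e0)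
  have F0: "fps_nth F 0 = 0" "fps_nth F 1 = 1" by (simp_all add: F fps_expansion_def f0 f1)
  define c1 c2 c3 where "c1 = fps_nth E 1" and "c2 = fps_nth E 2" and "c3 = fps_nth E 3"
  have H: "fps_nth H 0 = 1" "fps_nth H 1 = 2 * c1" "fps_nth H 2 = 2 * c2 + c1^2" "fps_nth H 3 = 2 * c3 + 2 * c1 * c2"
    by (simp_all add: H_def fps_mult_nth E0 c1_def c2_def c3_def eval_nat_numeral algebra_simps)
  have "fps_nth (H * F) n = fps_nth fps_X n" for n using EEF by (simp add: H_def)
  from this[of 2] this[of 3] this[of 4]
  have "fps_nth F 2 + fps_nth H 1 = 0" "fps_nth F 3 + fps_nth H 1 * fps_nth F 2 + fps_nth H 2 = 0"
    "fps_nth F 4 + fps_nth H 1 * fps_nth F 3 + fps_nth H 2 * fps_nth F 2 + fps_nth H 3 = 0"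
    using F0 H(1) by (simp_all add: fps_mult_nth fps_X_nth eval_nat_numeral algebra_simps)
  then have a2: "fps_nth F 2 = - 2 * c1" and b3: "fps_nth F 3 = - (2 * c1 * fps_nth F 2 + 2 * c2 + c1^2)"
    and b4: "fps_nth F 4 = - (2 * c1 * fps_nth F 3 + (2 * c2 + c1^2) * fps_nth F 2 + 2 * c3 + 2 * c1 * c2)"
    unfolding H by (simp_all add: add_eq_0_iff algebra_simps)
  have a3: "fps_nth F 3 = 3 * c1^2 - 2 * c2"
    unfolding b3 a2 by (simp add: algebra_simps power2_eq_square)
  have a4: "fps_nth F 4 = - 2 * c3 + 6 * c1 * c2 - 4 * c1^3"
    unfolding b4 a3 a2 by (simp add: algebra_simps power2_eq_square power3_eq_cube)
  obtain K where K: "K holomorphic_on ball 0 1" "\<And>z. z \<in> ball 0 1 \<Longrightarrow> e z = e 0 + z * K z"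
    "\<And>n. fps_nth (fps_expansion K 0) n = fps_nth (fps_expansion e 0) (Suc n)"
    by (rule holomorphic_on_ball_shift[OF e]) (rule that)
  define h where "h = (\<lambda>z. z * K (z^2))"
  have sq: "z^2 \<in> ball 0 1" if "z \<in> ball 0 1" for z :: complex
    using that by (simp add: norm_power abs_square_less_1)
  have h: "h holomorphic_on ball 0 1"
    unfolding h_def using sq
    by (auto intro!: holomorphic_intros holomorphic_on_compose_gen[OF _ K(1), unfolded o_def])
  have Fz: "1/z + h z = e (z^2) / z" if "z \<in> ball 0 1 - {0}" for z
    using K(2)[OF sq, of z] that by (simp add: h_def e0 field_simps power2_eq_square)
  \<comment> \<open>Since \<open>f (z^2) * (e (z^2) / z)^2 = 1\<close>, equal values force
    \<open>f (u^2) = f (v^2)\<close>, hence \<open>u^2 = v^2\<close>. The nonzero factors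
    \<open>e\<close> then agree, which excludes \<open>u = -v\<close>.\<close>
  have "inj_on (\<lambda>z. 1/z + h z) (ball 0 1 - {0})"
  proof (rule inj_onI)
    fix u v :: complex
    assume u: "u \<in> ball 0 1 - {0}" and v: "v \<in> ball 0 1 - {0}" and "1/u + h u = 1/v + h v"
    then have eq: "e (u^2) / u = e (v^2) / v" using Fz by simp
    have fe: "f (z^2) * (e (z^2) / z)^2 = 1" if "z \<in> ball 0 1 - {0}" for z
      using esq[OF sq, of z] that by (simp add: power2_eq_square field_simps)
    have "e (v^2) / v \<noteq> 0" using enz v by simp
    then have "f (u^2) = f (v^2)"
      using fe[OF u] fe[OF v] unfolding eq by (metis mult_right_cancel power_not_zero)
    moreover have "u^2 \<in> ball 0 1" "v^2 \<in> ball 0 1" using sq u v by blast+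
    ultimately have "u^2 = v^2" by (rule inj_onD[OF inj])
    then have "e (v^2) / u = e (v^2) / v" using eq by simp
    then show "u = v" using enz by simp
  qed
  \<comment> \<open>Five terms reach \<open>c3\<close>; the nonnegative terms of even degree are
    dropped at the end.\<close>
  from area_theorem[OF h _ this, of 5]
  have area: "(\<Sum>j<5. real (Suc j) * (norm (fps_nth (fps_expansion h 0) (Suc j)))^2) \<le> 1"
    by (simp add: h_def)
  have "fps_expansion h 0 = fps_X * (fps_expansion K 0 oo fps_X^2)"
  proof -
    have "(K \<circ> (\<lambda>z. z^2)) has_fps_expansion (fps_expansion K 0 oo fps_X^2)"
      by (intro fps_expansion_intros has_fps_expansion_fps_expansion[of "ball 0 1"] K) auto
    then have "h has_fps_expansion fps_X * (fps_expansion K 0 oo fps_X^2)"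
      unfolding h_def o_def by (intro fps_expansion_intros)
    moreover have "h has_fps_expansion fps_expansion h 0"
      by (intro has_fps_expansion_fps_expansion[of "ball 0 1"] h) auto
    ultimately show ?thesis using fps_expansion_unique_complex by metis
  qed
  then have "fps_nth (fps_expansion h 0) (Suc (2 * n)) = fps_nth E (Suc n)" for n
    by (simp add: fps_compose_nth K(3) E_def power_mult[symmetric] fps_X_power_nth if_distrib cong: if_cong)
  from this[of 0] this[of 1] this[of 2]
  have h135: "fps_nth (fps_expansion h 0) 1 = c1" "fps_nth (fps_expansion h 0) 3 = c2" "fps_nth (fps_expansion h 0) 5 = c3"
    by (simp_all add: c1_def c2_def c3_def eval_nat_numeral)
  have "(\<Sum>j<5. real (Suc j) * (norm (a (Suc j)))^2) =
      (norm (a 1))^2 + 2 * (norm (a 2))^2 + 3 * (norm (a 3))^2 + 4 * (norm (a 4))^2 + 5 * (norm (a 5))^2"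
    for a :: "nat \<Rightarrow> complex"
    by (simp add: eval_nat_numeral)
  from this[of "fps_nth (fps_expansion h 0)", unfolded h135]
  have "(norm c1)^2 + 3 * (norm c2)^2 + 5 * (norm c3)^2 \<le> 1"
    using area zero_le_power2[of "norm (fps_nth (fps_expansion h 0) 2)"]
      zero_le_power2[of "norm (fps_nth (fps_expansion h 0) 4)"] by linarith
  with a2 a3 a4 that show ?thesis by blast
qed

section \<open>Passage to the inverse function\<close>

text \<open>Power series depend only on germs at 0, so agreement near 0 yields the formal identity.
  Its linear coefficient gives \<open>deriv g 0 = 1\<close>, the normalisation that puts
  \<open>g\<close> in \<open>class_S\<close>.\<close>

lemma class_S_b_inverse:
  assumes f: "f \<in> class_S_b"
  obtains g where "g \<in> class_S" "fps_expansion f 0 oo fps_expansion g 0 = fps_X"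
proof -
  from f obtain g where fS: "f \<in> class_S" and g: "g holomorphic_on ball 0 1" "inj_on g (ball 0 1)"
    and gf: "\<forall>\<^sub>F w in nhds 0. g w = inv_into (ball 0 1) f w"
    unfolding class_S_b_def by blast
  have hol: "f holomorphic_on ball 0 1" and inj: "inj_on f (ball 0 1)" and f0: "f 0 = 0" and f1: "deriv f 0 = 1"
    using fS by (auto simp: class_S_def)
  have "g 0 = inv_into (ball 0 1) f (f 0)" using eventually_nhds_x_imp_x[OF gf] f0 by simp
  also have "\<dots> = 0" using inj by (intro inv_into_f_f) auto
  finally have g0: "g 0 = 0" .
  \<comment> \<open>The image is a neighbourhood of 0, so \<open>inv_into\<close> is a genuine right
    inverse of \<open>f\<close> there.\<close>
  have "open (f ` ball 0 1)"
    by (intro invariance_of_domain holomorphic_on_imp_continuous_on hol inj) auto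
  moreover have "0 \<in> f ` ball 0 1" using f0 by (force intro: image_eqI[of _ _ 0])
  ultimately have "\<forall>\<^sub>F w in nhds 0. w \<in> f ` ball 0 1" by (rule eventually_nhds_in_open)
  with gf have "\<forall>\<^sub>F w in nhds 0. (f \<circ> g) w = w"
    by eventually_elim (simp add: f_inv_into_f)
  moreover have expf: "f has_fps_expansion fps_expansion f 0" and expg: "g has_fps_expansion fps_expansion g 0"
    using hol g by (auto intro!: has_fps_expansion_fps_expansion[of "ball 0 1"])
  then have "(f \<circ> g) has_fps_expansion (fps_expansion f 0 oo fps_expansion g 0)"
    by (intro has_fps_expansion_compose) (auto simp: fps_expansion_def g0)
  ultimately have X: "fps_expansion f 0 oo fps_expansion g 0 = fps_X"
    using fps_expansion_unique_complex has_fps_expansion_cong has_fps_expansion_fps_X by metis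
  have "fps_nth (fps_expansion f 0 oo fps_expansion g 0) 1 = 1" unfolding X by simp
  then have "deriv g 0 = 1"
    by (simp add: fps_compose_nth fps_expansion_def f0 f1 g0)
  with g g0 have "g \<in> class_S" by (simp add: class_S_def)
  with X that show ?thesis by blast
qed

text \<open>\<open>G^k\<close> starts at degree \<open>k\<close>, so degrees 2 to 4 of the
  composition form a triangular system for the coefficients of \<open>G\<close>.\<close>

lemma fps_compose_inverse_coeffs:
  fixes F G :: "'a::comm_ring_1 fps"
  assumes F: "fps_nth F 0 = 0" "fps_nth F 1 = 1" and G: "fps_nth G 0 = 0" "fps_nth G 1 = 1"
    and X: "F oo G = fps_X"
  shows "fps_nth G 2 = - fps_nth F 2" "fps_nth G 3 = 2 * fps_nth F 2 ^ 2 - fps_nth F 3"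
    "fps_nth G 4 = - 5 * fps_nth F 2 ^ 3 + 5 * fps_nth F 2 * fps_nth F 3 - fps_nth F 4"
proof -
  have G2: "fps_nth (G^2) 0 = 0" "fps_nth (G^2) 1 = 0" "fps_nth (G^2) 2 = 1" "fps_nth (G^2) 3 = 2 * fps_nth G 2"
    "fps_nth (G^2) 4 = 2 * fps_nth G 3 + fps_nth G 2 ^ 2"
    using G by (simp_all add: power2_eq_square fps_mult_nth eval_nat_numeral algebra_simps)
  have p3: "G^3 = G^2 * G" and p4: "G^4 = G^3 * G"
    by (simp_all add: eval_nat_numeral mult_ac)
  have G3: "fps_nth (G^3) 0 = 0" "fps_nth (G^3) 1 = 0" "fps_nth (G^3) 2 = 0" "fps_nth (G^3) 3 = 1"
    "fps_nth (G^3) 4 = 3 * fps_nth G 2"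
    unfolding p3 using G G2 by (simp_all add: fps_mult_nth eval_nat_numeral algebra_simps)
  have G4: "fps_nth (G^4) 4 = 1"
    unfolding p4 using G G3 by (simp_all add: fps_mult_nth eval_nat_numeral algebra_simps)
  have sums: "{0..2} = {0,1,2::nat}" "{0..3} = {0,1,2,3::nat}" "{0..4} = {0,1,2,3,4::nat}" by auto
  have "fps_nth (F oo G) n = fps_nth fps_X n" for n by (simp add: X)
  from this[of 2] this[of 3] this[of 4]
  have "fps_nth G 2 + fps_nth F 2 = 0" "fps_nth G 3 + 2 * fps_nth F 2 * fps_nth G 2 + fps_nth F 3 = 0"
    "fps_nth G 4 + fps_nth F 2 * (2 * fps_nth G 3 + fps_nth G 2 ^ 2) + 3 * fps_nth F 3 * fps_nth G 2 + fps_nth F 4 = 0"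
    unfolding fps_compose_nth sums using F G G2 G3 G4
    by (simp_all add: fps_X_nth algebra_simps)
  then have 1: "fps_nth G 2 = - fps_nth F 2" "fps_nth G 3 = - (2 * fps_nth F 2 * fps_nth G 2 + fps_nth F 3)"
    "fps_nth G 4 = - (fps_nth F 2 * (2 * fps_nth G 3 + fps_nth G 2 ^ 2) + 3 * fps_nth F 3 * fps_nth G 2 + fps_nth F 4)"
    unfolding eq_neg_iff_add_eq_0 by (simp_all only: add.assoc)
  show "fps_nth G 2 = - fps_nth F 2" "fps_nth G 3 = 2 * fps_nth F 2 ^ 2 - fps_nth F 3"
    "fps_nth G 4 = - 5 * fps_nth F 2 ^ 3 + 5 * fps_nth F 2 * fps_nth F 3 - fps_nth F 4"
    by (simp_all add: 1 algebra_simps power2_eq_square power3_eq_cube)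
qed

theorem theorem4:
  shows "\<exists>g::real. 0.551 \<le> g \<and> g < 0.552 \<and> (\<forall>f \<in> class_S_b. norm (log_coeff f 3) \<le> g)"
proof (intro exI[of _ "0.55195"] conjI ballI)
  fix f assume f: "f \<in> class_S_b"
  then have fS: "f \<in> class_S" by (simp add: class_S_b_def)
  obtain g where gS: "g \<in> class_S" and X: "fps_expansion f 0 oo fps_expansion g 0 = fps_X"
    by (rule class_S_b_inverse[OF f]) (rule that)
  have nth: "fps_nth (fps_expansion u 0) 0 = 0 \<and> fps_nth (fps_expansion u 0) 1 = 1" if "u \<in> class_S" for u
    using that by (simp add: class_S_def fps_expansion_def)
  note inv = fps_compose_inverse_coeffs[OF nth[OF fS, THEN conjunct1] nth[OF fS, THEN conjunct2]
    nth[OF gS, THEN conjunct1] nth[OF gS, THEN conjunct2] X]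
  obtain c1 c2 c3 where c: "fps_nth (fps_expansion f 0) 2 = - 2 * c1" "fps_nth (fps_expansion f 0) 3 = 3 * c1^2 - 2 * c2"
    "fps_nth (fps_expansion f 0) 4 = - 2 * c3 + 6 * c1 * c2 - 4 * c1^3"
    and cn: "(norm c1)^2 + 3 * (norm c2)^2 + 5 * (norm c3)^2 \<le> 1"
    by (rule class_S_coeff_area[OF fS refl]) (rule that)
  obtain d1 d2 d3 where d: "fps_nth (fps_expansion g 0) 2 = - 2 * d1" "fps_nth (fps_expansion g 0) 3 = 3 * d1^2 - 2 * d2"
    "fps_nth (fps_expansion g 0) 4 = - 2 * d3 + 6 * d1 * d2 - 4 * d1^3"
    and dn: "(norm d1)^2 + 3 * (norm d2)^2 + 5 * (norm d3)^2 \<le> 1"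
    by (rule class_S_coeff_area[OF gS refl]) (rule that)
  have d1: "d1 = - c1" using inv(1) unfolding c d by algebra
  have "2 * d2 = - 2 * (c1^2 + c2)" using inv(2) unfolding c d d1 by algebra
  then have d2: "d2 = - (c1^2 + c2)" by algebra
  have "2 * d3 = 2 * (- 2 * c1^3 - 4 * c1 * c2 - c3)"
    using inv(3) unfolding c d d1 d2 by algebra
  then have d3: "d3 = - 2 * c1^3 - 4 * c1 * c2 - c3" by algebra
  have "log_coeff f 3 = - c3 + - c1 * - c2 + (- c1)^3/3"
    unfolding log_coeff_3[OF fS refl] c by (simp add: field_simps power2_eq_square power3_eq_cube)
  also have "norm \<dots> \<le> 0.55195"
  proof (rule functional_bound)
    have "(- c1)^2 - (- c2) = - d2" "2 * (- c1)^3 - 4 * (- c1) * (- c2) + (- c3) = d3"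
      by (simp_all add: d2 d3)
    then show "(norm (- c1))^2 + 3 * (norm ((- c1)^2 - (- c2)))^2 + 5 * (norm (2 * (- c1)^3 - 4 * (- c1) * (- c2) + (- c3)))^2 \<le> 1"
      using dn d1 by (simp only: norm_minus_cancel)
  qed (use cn in simp)
  finally show "norm (log_coeff f 3) \<le> 0.55195" .
qed simp_all

end
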